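(* Each of the following score sequences of tournaments on 8 vertices, and each of their dual score sequences, has an intrinsically linked representative: $(2,3,3,3,3,4,4,6)$, $(1,3,3,3,3,4,5,6)$, $(1,3,3,3,4,4,5,5)$ and $(2,2,3,3,3,4,5,6)$.
   Context: A tournament is a directed graph with exactly one directed edge between each pair of distinct vertices. Its score sequence is the list of outdegrees of its vertices in non-decreasing order. The dual of a score sequence $S$ is the score sequence of the tournament obtained by reversing all edges of a tournament with score sequence $S$; the dual of $(s_1,\dots,s_n)$ is $(n-1-s_n,\dots,n-1-s_1)$. A cycle in a directed graph is consistently oriented if it is a directed cycle. A directed graph $G$ is intrinsically linked as a directed graph if every (tame) embedding of $G$ into $S^3$ contains two vertex-disjoint consistently oriented cycles that form a non-split link. A score sequence $S$ has an intrinsically linked representative if there exists a tournament with score sequence $S$ that is intrinsically linked as a directed graph. *)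

theory Defs
  imports "HOL-Analysis.Analysis" "Graph_Theory.Graph_Theory"
begin

section \<open>Tournaments and score sequences\<close>

locale tournament = digraph +
  assumes one_arc: "\<lbrakk>u \<in> verts G; v \<in> verts G; u \<noteq> v\<rbrakk>
    \<Longrightarrow> \<exists>!e. e \<in> arcs G \<and> {tail G e, head G e} = {u, v}"

definition score_sequence :: "('a, 'b) pre_digraph \<Rightarrow> nat list" where
  "score_sequence G =
     sorted_list_of_multiset (image_mset (out_degree G) (mset_set (verts G)))"

definition reverse_digraph :: "('a, 'b) pre_digraph \<Rightarrow> ('a, 'b) pre_digraph" where
  "reverse_digraph G = \<lparr>verts = verts G, arcs = arcs G, tail = head G, head = tail G\<rparr>"

text \<open>The natural-number subtraction does not truncate when \<open>S\<close> is the score sequence of a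
  tournament; the lemma \<open>score_sequence_reverse\<close> below says that this is the score sequence of
  the reversed tournament.\<close>

definition dual_score :: "nat list \<Rightarrow> nat list" where
  "dual_score S = rev (map (\<lambda>s. length S - 1 - s) S)"

lemma (in tournament) in_out_degree:
  assumes v: "v \<in> verts G"
  shows "in_degree G v + out_degree G v = card (verts G) - 1"
proof -
  define f where "f e = (if tail G e = v then head G e else tail G e)" for e
  have inj: "inj_on f (in_arcs G v \<union> out_arcs G v)"
  proof (rule inj_onI)
    fix a b assume a: "a \<in> in_arcs G v \<union> out_arcs G v" and b: "b \<in> in_arcs G v \<union> out_arcs G v"
      and eq: "f a = f b"
    have ends: "{tail G a, head G a} = {v, f a}" "{tail G b, head G b} = {v, f b}"
      using a b by (auto simp: f_def)
    have arcs: "a \<in> arcs G" "b \<in> arcs G" using a b by auto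
    have "f a \<in> verts G" "f a \<noteq> v" using a no_loops[of a] by (auto simp: f_def)
    then show "a = b" using one_arc[OF v, of "f a"] ends arcs eq by metis
  qed
  have img: "f ` (in_arcs G v \<union> out_arcs G v) = verts G - {v}"
  proof (intro equalityI subsetI)
    fix u assume "u \<in> f ` (in_arcs G v \<union> out_arcs G v)"
    then obtain e where "e \<in> in_arcs G v \<union> out_arcs G v" "u = f e" by blast
    then show "u \<in> verts G - {v}" using no_loops[of e] by (auto simp: f_def)
  next
    fix u assume u: "u \<in> verts G - {v}"
    then obtain e where e: "e \<in> arcs G" "{tail G e, head G e} = {v, u}"
      using one_arc[OF v, of u] by blast
    then have "e \<in> in_arcs G v \<union> out_arcs G v" "f e = u"
      using u by (auto simp: f_def doubleton_eq_iff)
    then show "u \<in> f ` (in_arcs G v \<union> out_arcs G v)" by blast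
  qed
  have "card (in_arcs G v \<union> out_arcs G v) = card (verts G) - 1"
    using card_image[OF inj] img v by simp
  moreover have "in_arcs G v \<inter> out_arcs G v = {}" using no_loops by force
  ultimately show ?thesis
    unfolding in_degree_def out_degree_def
    by (simp add: card_Un_disjoint finite_in_arcs finite_out_arcs)
qed

lemma (in tournament) score_sequence_reverse:
  "score_sequence (reverse_digraph G) = dual_score (score_sequence G)"
proof -
  let ?n = "card (verts G)"
  have len: "length (score_sequence G) = ?n"
    unfolding score_sequence_def by (metis mset_sorted_list_of_multiset size_mset size_image_mset size_mset_set)
  have deg: "out_degree (reverse_digraph G) v = ?n - 1 - out_degree G v" if "v \<in> verts G" for v
    using in_out_degree[OF that]
    by (simp add: reverse_digraph_def out_degree_def in_degree_def out_arcs_def in_arcs_def)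
  have "mset (dual_score (score_sequence G))
      = image_mset (\<lambda>v. ?n - 1 - out_degree G v) (mset_set (verts G))"
    unfolding dual_score_def len
    by (simp add: score_sequence_def image_mset.compositionality comp_def)
  also have "\<dots> = image_mset (out_degree (reverse_digraph G)) (mset_set (verts G))"
    by (rule image_mset_cong) (simp add: deg)
  finally have m: "mset (dual_score (score_sequence G)) = mset (score_sequence (reverse_digraph G))"
    by (simp add: score_sequence_def reverse_digraph_def)
  have "sorted (score_sequence G)" by (simp add: score_sequence_def)
  then have "sorted (dual_score (score_sequence G))"
    unfolding dual_score_def sorted_wrt_rev sorted_wrt_map
    by (rule sorted_wrt_mono_rel[rotated]) auto
  then show ?thesis
    using m by (metis score_sequence_def sorted_list_of_multiset_mset sorted_sort_id mset_sorted_list_of_multiset)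
qed


section \<open>Tame embeddings of digraphs in the 3-sphere\<close>

abbreviation S3 :: "(real^4) set" where
  "S3 \<equiv> sphere 0 1"

text \<open>An embedding of the underlying topological graph of a loopfree digraph, given by the images
  \<open>p v\<close> of the vertices and by an arc \<open>g e\<close> for each edge \<open>e\<close>, running from tail to head: distinct
  edges meet only in vertices, and an edge meets no vertices but its own endpoints.\<close>

definition S3_embedding ::
  "('a, 'b) pre_digraph \<Rightarrow> ('a \<Rightarrow> real^4) \<Rightarrow> ('b \<Rightarrow> real \<Rightarrow> real^4) \<Rightarrow> bool" where
  "S3_embedding G p g \<longleftrightarrow>
     inj_on p (verts G) \<and> p ` verts G \<subseteq> S3 \<and>
     (\<forall>e\<in>arcs G. arc (g e) \<and> path_image (g e) \<subseteq> S3 \<and>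
        pathstart (g e) = p (tail G e) \<and> pathfinish (g e) = p (head G e) \<and>
        path_image (g e) \<inter> p ` verts G = {p (tail G e), p (head G e)}) \<and>
     (\<forall>e\<in>arcs G. \<forall>f\<in>arcs G. e \<noteq> f \<longrightarrow>
        path_image (g e) \<inter> path_image (g f) \<subseteq> p ` verts G)"

definition embedded_image ::
  "('a, 'b) pre_digraph \<Rightarrow> ('a \<Rightarrow> real^4) \<Rightarrow> ('b \<Rightarrow> real \<Rightarrow> real^4) \<Rightarrow> (real^4) set" where
  "embedded_image G p g = p ` verts G \<union> (\<Union>e\<in>arcs G. path_image (g e))"

definition polygonal :: "(real^3) set \<Rightarrow> bool" where
  "polygonal A \<longleftrightarrow> (\<exists>P. finite P \<and> A = (\<Union>(a, b)\<in>P. closed_segment a b))"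

text \<open>Tame means ambient homeomorphic to a polygonal graph. Polygonality is a notion of
  \<open>\<real>\<^sup>3\<close>, so we identify the complement of a point off the graph with \<open>\<real>\<^sup>3\<close>; the homeomorphisms of
  such a complement onto \<open>\<real>\<^sup>3\<close> are the homeomorphisms of the 3-sphere onto the one-point
  compactification of \<open>\<real>\<^sup>3\<close> that take the point to infinity.\<close>

definition tame_S3_embedding ::
  "('a, 'b) pre_digraph \<Rightarrow> ('a \<Rightarrow> real^4) \<Rightarrow> ('b \<Rightarrow> real \<Rightarrow> real^4) \<Rightarrow> bool" where
  "tame_S3_embedding G p g \<longleftrightarrow> S3_embedding G p g \<and>
     (\<exists>q \<in> S3 - embedded_image G p g. \<exists>h k.
        homeomorphism (S3 - {q}) (UNIV :: (real^3) set) h k \<and>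
        (\<forall>e\<in>arcs G. polygonal (h ` path_image (g e))))"


section \<open>Split links and intrinsic linking\<close>

text \<open>In the tame category a 2-sphere in the 3-sphere is unknotted (Alexander), that is, the image
  of an equator under a self-homeomorphism of the 3-sphere.\<close>

definition tame_2sphere :: "(real^4) set \<Rightarrow> bool" where
  "tame_2sphere F \<longleftrightarrow> (\<exists>h k. homeomorphism S3 S3 h k \<and> F = h ` {x \<in> S3. x $ 1 = 0})"

definition split_link :: "(real^4) set \<Rightarrow> (real^4) set \<Rightarrow> bool" where
  "split_link J K \<longleftrightarrow> (\<exists>F A B. tame_2sphere F \<and>
     A \<in> components (S3 - F) \<and> B \<in> components (S3 - F) \<and> A \<noteq> B \<and> J \<subseteq> A \<and> K \<subseteq> B)"

text \<open>\<open>pre_digraph.cycle G c\<close> says that the list of edges \<open>c\<close> is a directed cycle; the vertices on it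
  are the tails of its edges.\<close>

definition intrinsically_linked :: "('a, 'b) pre_digraph \<Rightarrow> bool" where
  "intrinsically_linked G \<longleftrightarrow> (\<forall>p g. tame_S3_embedding G p g \<longrightarrow>
     (\<exists>c d. pre_digraph.cycle G c \<and> pre_digraph.cycle G d \<and>
        tail G ` set c \<inter> tail G ` set d = {} \<and>
        \<not> split_link (\<Union>e\<in>set c. path_image (g e)) (\<Union>e\<in>set d. path_image (g e))))"

text \<open>Every tournament is isomorphic to one on natural numbers whose edges are pairs, so fixing
  these types loses no generality.\<close>

definition has_intrinsically_linked_representative :: "nat list \<Rightarrow> bool" where
  "has_intrinsically_linked_representative S \<longleftrightarrow>
     (\<exists>G :: (nat, nat \<times> nat) pre_digraph.
        tournament G \<and> score_sequence G = S \<and> intrinsically_linked G)"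

end

theory Submission
  imports Defs "HOL-Library.Z2" "HOL-Real_Asymp.Real_Asymp"
begin

text \<open>One digraph on eight vertices, the 23 arcs called \<open>core\<close> below, is responsible for all eight score
sequences. It contains sixteen pairs of disjoint directed cycles (\<open>cycle_pairs\<close>) whose linking
numbers mod 2 add up to 1 in every embedding. Hence one of the pairs always has odd linking number,
and such a pair is not split. The five edges that \<open>core\<close> leaves open can be oriented to reach each of
the four score sequences, and reversing all arcs gives the duals.

The sum of the linking numbers is computed from a generic diagram of the graph. The linking number of
two disjoint cycles is the sum of the parities \<open>X e f\<close> of the crossings at which an edge \<open>e\<close> of the
first passes over an edge \<open>f\<close> of the second. The parity \<open>X e f + X f e\<close> of all crossings of the two
edges is determined by the positions of the end points of each edge relative to the other edge and
by the order of the four end points from west to east (\<open>crossings_swap\<close>). In the sum over the sixteen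
pairs every unordered pair of disjoint edges occurs an even number of times, so after exchanging
some terms the crossing numbers cancel; so do the positions of vertices relative to edges; and of
the order relations an odd number of inversions survives whatever the order of the vertices is
(\<open>cycle_pairs_sum\<close>). This is the argument of Conway, Gordon and Sachs for the complete graph on six
vertices, in a form that needs only directed cycles.

Diagrams come from polygonal approximations. The complement of a point off the graph is identified with
\<open>\<real>\<^sup>3\<close>, the edges are sampled at finitely many points, and the sample points are moved slightly into
general position; edges without a common vertex keep a positive distance.

A split pair has linking number 0 for all fine approximations. One side of the splitting sphere is a
contractible set that avoids the point at infinity, contains one of the cycles and misses the other
(\<open>split_link_contractible_side\<close>). Contracting the cycle inside this set sweeps it through small triangles
that are disjoint from the other cycle, and the boundary of a triangle has linking number 0 with every
closed polygon that misses the triangle (\<open>over_triangle\<close>, \<open>contracted_link_zero\<close>).\<close>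

section \<open>Crossings of segments in general position\<close>

text \<open>Sums in \<open>bit\<close> are kept as sums: the default rewriting into exclusive or hides cancellation from the
simplifier.\<close>

declare add_bit_eq_xor [simp del] mult_bit_eq_and [simp del]

lemma bit_add_self [simp]: "a + a = (0::bit)" "a + (a + b) = (b::bit)"
  by (cases a; cases b; simp)+

text \<open>The coordinates of a point of \<open>\<real>\<^sup>3\<close> are read as west-east, south-north and height. Each of the
functions \<open>west\<close>, \<open>below\<close>, \<open>over\<close> records, for two objects that agree in the earlier coordinates,
which of them comes first in the next one: two points, a point and a segment, two segments. In
general position, exchanging the two objects changes the last of these functions by a correction
that involves only the other two (Steenrod's cup-i products in miniature).\<close>

definition west :: "real^3 \<Rightarrow> real^3 \<Rightarrow> bit" where
  "west p q = of_bool (p $ 1 < q $ 1)"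

definition below :: "real^3 \<Rightarrow> real^3 \<Rightarrow> real^3 \<Rightarrow> bit" where
  "below p a b = of_bool (\<exists>r\<in>closed_segment a b. r $ 1 = p $ 1 \<and> p $ 2 < r $ 2)"

definition meet :: "real^3 \<Rightarrow> real^3 \<Rightarrow> real^3 \<Rightarrow> real^3 \<Rightarrow> bit" where
  "meet a b c d = of_bool (\<exists>p\<in>closed_segment a b. \<exists>q\<in>closed_segment c d. p $ 1 = q $ 1 \<and> p $ 2 = q $ 2)"

definition over :: "real^3 \<Rightarrow> real^3 \<Rightarrow> real^3 \<Rightarrow> real^3 \<Rightarrow> bit" where
  "over a b c d = of_bool (\<exists>p\<in>closed_segment a b. \<exists>q\<in>closed_segment c d.
     p $ 1 = q $ 1 \<and> p $ 2 = q $ 2 \<and> q $ 3 < p $ 3)"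

text \<open>The parametrisation of the line through \<open>a\<close> and \<open>b\<close> by the first coordinate.\<close>

definition along :: "real^3 \<Rightarrow> real^3 \<Rightarrow> real \<Rightarrow> real^3" where
  "along a b x = a + ((x - a $ 1) / (b $ 1 - a $ 1)) *\<^sub>R (b - a)"

text \<open>General position of the shadows in the horizontal plane: distinct first coordinates, and no three
shadows on a line. Heights are unconstrained, because segments that are disjoint have different
heights where their shadows cross.\<close>

definition generic :: "(real^3) set \<Rightarrow> bool" where
  "generic S \<longleftrightarrow> inj_on (\<lambda>p. p $ 1) S \<and>
     (\<forall>a\<in>S. \<forall>b\<in>S. \<forall>c\<in>S. a \<noteq> b \<and> a \<noteq> c \<and> b \<noteq> c \<longrightarrow> along a b (c $ 1) $ 2 \<noteq> c $ 2)"

lemma generic_subset: "generic T \<Longrightarrow> S \<subseteq> T \<Longrightarrow> generic S"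
  unfolding generic_def by (meson inj_on_subset subsetD)

lemma below_commute: "below p a b = below p b a"
  by (simp add: below_def closed_segment_commute)
lemma meet_commute: "meet a b c d = meet b a c d" "meet a b c d = meet a b d c"
  by (simp_all add: meet_def closed_segment_commute)
lemma over_commute: "over a b c d = over b a c d" "over a b c d = over a b d c"
  by (simp_all add: over_def closed_segment_commute)
lemma along_1: "a $ 1 \<noteq> b $ 1 \<Longrightarrow> along a b x $ 1 = x"
  by (simp add: along_def)

lemma along_2: "along a b x $ 2 = a $ 2 + ((x - a $ 1) / (b $ 1 - a $ 1)) * (b $ 2 - a $ 2)"
  by (simp add: along_def)

lemma along_commute: "a $ 1 \<noteq> b $ 1 \<Longrightarrow> along b a x = along a b x"
  unfolding along_def vec_eq_iff by (auto simp: divide_simps) (simp add: algebra_simps)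

lemma along_left: "along a b (a $ 1) = a"
  by (simp add: along_def)
lemma along_right: "a $ 1 \<noteq> b $ 1 \<Longrightarrow> along a b (b $ 1) = b"
  by (simp add: along_def)

lemma in_segment_along:
  assumes "a $ 1 < b $ 1"
  shows "r \<in> closed_segment a b \<longleftrightarrow> a $ 1 \<le> r $ 1 \<and> r $ 1 \<le> b $ 1 \<and> r = along a b (r $ 1)"
proof
  assume "r \<in> closed_segment a b"
  then obtain u where u: "0 \<le> u" "u \<le> 1" "r = (1 - u) *\<^sub>R a + u *\<^sub>R b"
    unfolding closed_segment_def by auto
  have r1: "r $ 1 = a $ 1 + u * (b $ 1 - a $ 1)" unfolding u(3) by (simp add: algebra_simps)
  then have q: "(r $ 1 - a $ 1) / (b $ 1 - a $ 1) = u" using assms by simp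
  have "r = along a b (r $ 1)" unfolding along_def q using u(3) by (simp add: algebra_simps)
  moreover have "u * (b $ 1 - a $ 1) \<le> b $ 1 - a $ 1" "0 \<le> u * (b $ 1 - a $ 1)"
    using u assms by (auto simp: mult_left_le_one_le)
  ultimately show "a $ 1 \<le> r $ 1 \<and> r $ 1 \<le> b $ 1 \<and> r = along a b (r $ 1)"
    unfolding r1 by simp
next
  assume r: "a $ 1 \<le> r $ 1 \<and> r $ 1 \<le> b $ 1 \<and> r = along a b (r $ 1)"
  define u where "u = (r $ 1 - a $ 1) / (b $ 1 - a $ 1)"
  have "r = (1 - u) *\<^sub>R a + u *\<^sub>R b" 
    using r unfolding along_def u_def[symmetric] by (simp add: algebra_simps)
  moreover have "0 \<le> u" "u \<le> 1" using r assms by (auto simp: u_def)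
  ultimately show "r \<in> closed_segment a b" unfolding closed_segment_def by blast
qed

lemma below_along:
  assumes "a $ 1 < b $ 1"
  shows "below p a b = of_bool (a $ 1 \<le> p $ 1 \<and> p $ 1 \<le> b $ 1 \<and> p $ 2 < along a b (p $ 1) $ 2)"
proof -
  have "(\<exists>r\<in>closed_segment a b. r $ 1 = p $ 1 \<and> p $ 2 < r $ 2)
    \<longleftrightarrow> a $ 1 \<le> p $ 1 \<and> p $ 1 \<le> b $ 1 \<and> p $ 2 < along a b (p $ 1) $ 2"
    using in_segment_along[OF assms] along_1[of a b "p $ 1"] assms by (metis less_irrefl)
  then show ?thesis by (simp add: below_def)
qed

lemma meet_along:
  assumes "a $ 1 < b $ 1" "c $ 1 < d $ 1"
  shows "meet a b c d = of_bool (\<exists>x. max (a $ 1) (c $ 1) \<le> x \<and> x \<le> min (b $ 1) (d $ 1)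
    \<and> along a b x $ 2 = along c d x $ 2)"
proof -
  have "(\<exists>p\<in>closed_segment a b. \<exists>q\<in>closed_segment c d. p $ 1 = q $ 1 \<and> p $ 2 = q $ 2)
    \<longleftrightarrow> (\<exists>x. max (a $ 1) (c $ 1) \<le> x \<and> x \<le> min (b $ 1) (d $ 1)
    \<and> along a b x $ 2 = along c d x $ 2)" (is "?L \<longleftrightarrow> ?R")
  proof
    assume ?L
    then show ?R using in_segment_along[OF assms(1)] in_segment_along[OF assms(2)]
      by (metis max.boundedI min.boundedI)
  next
    assume ?R
    then obtain x where x: "a $ 1 \<le> x" "c $ 1 \<le> x" "x \<le> b $ 1" "x \<le> d $ 1"
      "along a b x $ 2 = along c d x $ 2" by auto
    have e: "along a b x $ 1 = x" "along c d x $ 1 = x"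
      using assms by (simp_all add: along_1)
    have "along a b x \<in> closed_segment a b" "along c d x \<in> closed_segment c d"
      using in_segment_along[OF assms(1)] in_segment_along[OF assms(2)] x e by metis+
    then show ?L using x e by metis
  qed
  then show ?thesis by (simp add: meet_def)
qed

lemma affine_root:
  fixes m k :: real
  assumes "l < r" "m * l + k \<noteq> 0" "m * r + k \<noteq> 0"
  shows "(\<exists>x. l \<le> x \<and> x \<le> r \<and> m * x + k = 0) \<longleftrightarrow> (m * l + k > 0) \<noteq> (m * r + k > 0)"
proof
  assume "\<exists>x. l \<le> x \<and> x \<le> r \<and> m * x + k = 0"
  then obtain x where x: "l \<le> x" "x \<le> r" "m * x + k = 0" by blast
  have "l \<noteq> x" "r \<noteq> x" using x assms by auto
  then have lt: "l < x" "x < r" using x by auto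
  have e: "m * l + k = m * (l - x)" "m * r + k = m * (r - x)"
    using x by (simp_all add: algebra_simps)
  have "m \<noteq> 0" using e assms by auto
  then show "(m * l + k > 0) \<noteq> (m * r + k > 0)" unfolding e 
    using lt by (auto simp: zero_less_mult_iff)
next
  assume s: "(m * l + k > 0) \<noteq> (m * r + k > 0)"
  have c: "continuous_on {l..r} (\<lambda>x. m * x + k)" by (intro continuous_intros)
  from s assms consider "m * l + k \<le> 0" "0 \<le> m * r + k" | "m * r + k \<le> 0" "0 \<le> m * l + k"
    by linarith
  then show "\<exists>x. l \<le> x \<and> x \<le> r \<and> m * x + k = 0"
    using IVT'[of "\<lambda>x. m * x + k" l 0 r] IVT2'[of "\<lambda>x. m * x + k" r 0 l] c assms(1) by cases auto
qed

text \<open>Over the common part of their first coordinates, the difference of the second coordinates of two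
segments is an affine function; the shadows cross iff its signs at the two ends of the common part
differ. These ends are end points of the segments, and which ones is decided by the order of the
first coordinates.\<close>

lemma planar_crossing:
  assumes g: "generic {a, b, c, d}" and dist: "distinct [a, b, c, d]"
  shows "meet a b c d = below a c d + below b c d + below c a b + below d a b
     + (west a c + west a d + west b c + west b d)"
proof -
  have goal: "meet a b c d = below a c d + below b c d + below c a b + below d a b
     + (west a c + west a d + west b c + west b d)"
    if g: "generic {a, b, c, d}" and dist: "distinct [a, b, c, d]"
    and o: "a $ 1 < b $ 1" "c $ 1 < d $ 1" for a b c d
  proof -
    \<comment> \<open>The affine function \<open>m * x + k\<close> is the second coordinate of the line \<open>ab\<close> minus that of \<open>cd\<close>.\<close>
    define m where "m = (b $ 2 - a $ 2) / (b $ 1 - a $ 1) - (d $ 2 - c $ 2) / (d $ 1 - c $ 1)"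
    define k where "k = a $ 2 - a $ 1 * (b $ 2 - a $ 2) / (b $ 1 - a $ 1)
      - (c $ 2 - c $ 1 * (d $ 2 - c $ 2) / (d $ 1 - c $ 1))"
    have D: "along a b x $ 2 - along c d x $ 2 = m * x + k" for x
      using o unfolding along_2 m_def k_def by (simp add: diff_divide_distrib algebra_simps)
    have ne: "a $ 1 \<noteq> b $ 1" "c $ 1 \<noteq> d $ 1" using o by auto
    have ends: "along a b (a $ 1) = a" "along a b (b $ 1) = b" "along c d (c $ 1) = c" "along c d (d $ 1) = d"
      using ne by (simp_all add: along_left along_right)
    have n1: "a $ 1 \<noteq> c $ 1" "a $ 1 \<noteq> d $ 1" "b $ 1 \<noteq> c $ 1" "b $ 1 \<noteq> d $ 1"
      using g dist unfolding generic_def inj_on_def by auto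
    have n2: "along c d (a $ 1) $ 2 \<noteq> a $ 2" "along c d (b $ 1) $ 2 \<noteq> b $ 2"
      "along a b (c $ 1) $ 2 \<noteq> c $ 2" "along a b (d $ 1) $ 2 \<noteq> d $ 2"
      using g dist unfolding generic_def by auto
    have nz: "m * a $ 1 + k \<noteq> 0" "m * b $ 1 + k \<noteq> 0" "m * c $ 1 + k \<noteq> 0" "m * d $ 1 + k \<noteq> 0"
      using n2 ends D by (metis right_minus_eq)+
    have B: "a $ 2 < along c d (a $ 1) $ 2 \<longleftrightarrow> \<not> m * a $ 1 + k > 0"
      "b $ 2 < along c d (b $ 1) $ 2 \<longleftrightarrow> \<not> m * b $ 1 + k > 0"
      "c $ 2 < along a b (c $ 1) $ 2 \<longleftrightarrow> m * c $ 1 + k > 0"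
      "d $ 2 < along a b (d $ 1) $ 2 \<longleftrightarrow> m * d $ 1 + k > 0"
      using D[of "a $ 1"] D[of "b $ 1"] D[of "c $ 1"] D[of "d $ 1"] nz ends by auto
    have M: "along a b x $ 2 = along c d x $ 2 \<longleftrightarrow> m * x + k = 0" for x
      using D[of x] by auto
    have rt: "(\<exists>x. l \<le> x \<and> x \<le> r \<and> m * x + k = 0) \<longleftrightarrow> (m * l + k > 0) \<noteq> (m * r + k > 0)"
      if "l < r" "l \<in> {a $ 1, b $ 1, c $ 1, d $ 1}" "r \<in> {a $ 1, b $ 1, c $ 1, d $ 1}" for l r
      using affine_root[of l r m k] that nz by auto
    consider "b $ 1 < c $ 1" | "d $ 1 < a $ 1" | "a $ 1 < c $ 1" "c $ 1 < b $ 1" "b $ 1 < d $ 1"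
      | "a $ 1 < c $ 1" "c $ 1 < b $ 1" "d $ 1 < b $ 1"
      | "c $ 1 < a $ 1" "a $ 1 < d $ 1" "d $ 1 < b $ 1"
      | "c $ 1 < a $ 1" "b $ 1 < d $ 1"
      using n1 o by linarith
    then show ?thesis
    proof cases
      case 1
      then have "\<not> (\<exists>x. max (a $ 1) (c $ 1) \<le> x \<and> x \<le> min (b $ 1) (d $ 1) \<and> m * x + k = 0)" by auto
      then show ?thesis unfolding meet_along[OF o] below_along[OF o(1)] below_along[OF o(2)] west_def M B
        using 1 o by (simp add: add_bit_eq_xor)
    next
      case 2
      then have "\<not> (\<exists>x. max (a $ 1) (c $ 1) \<le> x \<and> x \<le> min (b $ 1) (d $ 1) \<and> m * x + k = 0)" by auto
      then show ?thesis unfolding meet_along[OF o] below_along[OF o(1)] below_along[OF o(2)] west_def M B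
        using 2 o by (simp add: add_bit_eq_xor)
    next
      case 3
      then have "max (a $ 1) (c $ 1) = c $ 1" "min (b $ 1) (d $ 1) = b $ 1" by auto
      then show ?thesis unfolding meet_along[OF o] below_along[OF o(1)] below_along[OF o(2)] west_def M B
        using 3 o rt[of "c $ 1" "b $ 1"] by (simp add: add_bit_eq_xor)
    next
      case 4
      then have "max (a $ 1) (c $ 1) = c $ 1" "min (b $ 1) (d $ 1) = d $ 1" by auto
      then show ?thesis unfolding meet_along[OF o] below_along[OF o(1)] below_along[OF o(2)] west_def M B
        using 4 o rt[of "c $ 1" "d $ 1"] by (simp add: add_bit_eq_xor)
    next
      case 5
      then have "max (a $ 1) (c $ 1) = a $ 1" "min (b $ 1) (d $ 1) = d $ 1" by auto
      then show ?thesis unfolding meet_along[OF o] below_along[OF o(1)] below_along[OF o(2)] west_def M B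
        using 5 o rt[of "a $ 1" "d $ 1"] by (simp add: add_bit_eq_xor)
    next
      case 6
      then have "max (a $ 1) (c $ 1) = a $ 1" "min (b $ 1) (d $ 1) = b $ 1" by auto
      then show ?thesis unfolding meet_along[OF o] below_along[OF o(1)] below_along[OF o(2)] west_def M B
        using 6 o rt[of "a $ 1" "b $ 1"] by (simp add: add_bit_eq_xor)
    qed
  qed
  have n: "a $ 1 \<noteq> b $ 1" "c $ 1 \<noteq> d $ 1"
    using g dist unfolding generic_def inj_on_def by auto
  have s: "{b, a, c, d} = {a, b, c, d}" "{a, b, d, c} = {a, b, c, d}" "{b, a, d, c} = {a, b, c, d}" by auto
  consider "a $ 1 < b $ 1" "c $ 1 < d $ 1" | "b $ 1 < a $ 1" "c $ 1 < d $ 1" 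
    | "a $ 1 < b $ 1" "d $ 1 < c $ 1" | "b $ 1 < a $ 1" "d $ 1 < c $ 1" using n by linarith
  then show ?thesis
  proof cases
    case 1 then show ?thesis using goal[of a b c d] g dist by simp
  next
    case 2
    then have "meet b a c d = below b c d + below a c d + below c b a + below d b a
       + (west b c + west b d + west a c + west a d)"
      using goal[of b a c d] g dist unfolding s by auto
    then show ?thesis
      by (simp only: meet_commute(1)[of b a] below_commute[of _ b a] ac_simps)
  next
    case 3
    then have "meet a b d c = below a d c + below b d c + below d a b + below c a b
       + (west a d + west a c + west b d + west b c)"
      using goal[of a b d c] g dist unfolding s by auto
    then show ?thesis
      by (simp only: meet_commute(2)[of a b d c] below_commute[of _ d c] ac_simps)
  next
    case 4
    then have "meet b a d c = below b d c + below a d c + below d b a + below c b a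
       + (west b d + west b c + west a d + west a c)"
      using goal[of b a d c] g dist unfolding s by auto
    then show ?thesis
      by (simp only: meet_commute(1)[of b a] meet_commute(2)[of a b d c] below_commute[of _ d c] 
        below_commute[of _ b a] ac_simps)
  qed
qed

section \<open>Triangles and segments\<close>

text \<open>Two vertically aligned pairs of points in opposite order could be joined by a segment of aligned
pairs, and a pair of equal heights on it would be a common point.\<close>

lemma vertical_order:
  fixes S T :: "(real^3) set"
  assumes "convex S" "convex T" "S \<inter> T = {}"
  shows "(\<forall>p\<in>S. \<forall>q\<in>T. p $ 1 = q $ 1 \<and> p $ 2 = q $ 2 \<longrightarrow> q $ 3 < p $ 3) \<or>
         (\<forall>p\<in>S. \<forall>q\<in>T. p $ 1 = q $ 1 \<and> p $ 2 = q $ 2 \<longrightarrow> p $ 3 < q $ 3)"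
proof (rule ccontr)
  assume "\<not> ?thesis"
  then obtain p q p' q' where pq: "p \<in> S" "q \<in> T" "p $ 1 = q $ 1" "p $ 2 = q $ 2" "p $ 3 \<le> q $ 3"
    and pq': "p' \<in> S" "q' \<in> T" "p' $ 1 = q' $ 1" "p' $ 2 = q' $ 2" "q' $ 3 \<le> p' $ 3"
    by (meson not_less)
  have "p \<noteq> q" using pq assms(3) by auto
  then have "p $ 3 < q $ 3" using pq by (auto simp: vec_eq_iff forall_3)
  define l where "l = (q $ 3 - p $ 3) / ((q $ 3 - p $ 3) + (p' $ 3 - q' $ 3))"
  have pos: "(q $ 3 - p $ 3) + (p' $ 3 - q' $ 3) > 0" using \<open>p $ 3 < q $ 3\<close> pq' by simp
  have l: "0 \<le> l" "l \<le> 1" unfolding l_def using pos \<open>p $ 3 < q $ 3\<close> pq'(5) by simp_all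
  have "l * ((q $ 3 - p $ 3) + (p' $ 3 - q' $ 3)) = q $ 3 - p $ 3" unfolding l_def using pos by simp
  then have "(1 - l) * p $ 3 + l * p' $ 3 = (1 - l) * q $ 3 + l * q' $ 3" by (simp add: algebra_simps)
  then have "(1 - l) *\<^sub>R p + l *\<^sub>R p' = (1 - l) *\<^sub>R q + l *\<^sub>R q'"
    using pq pq' unfolding vec_eq_iff forall_3 by simp
  moreover have "(1 - l) *\<^sub>R p + l *\<^sub>R p' \<in> S" "(1 - l) *\<^sub>R q + l *\<^sub>R q' \<in> T"
    using convexD[OF assms(1) pq(1) pq'(1), of "1 - l" l] convexD[OF assms(2) pq(2) pq'(2), of "1 - l" l] l
    by simp_all
  ultimately show False using assms(3) by (metis disjoint_iff)
qed

lemma over_add_over: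
  assumes "closed_segment a b \<inter> closed_segment c d = {}"
  shows "over a b c d + over c d a b = meet a b c d"
proof -
  consider "\<forall>p\<in>closed_segment a b. \<forall>q\<in>closed_segment c d. p $ 1 = q $ 1 \<and> p $ 2 = q $ 2 \<longrightarrow> q $ 3 < p $ 3"
    | "\<forall>p\<in>closed_segment a b. \<forall>q\<in>closed_segment c d. p $ 1 = q $ 1 \<and> p $ 2 = q $ 2 \<longrightarrow> p $ 3 < q $ 3"
    using vertical_order[OF _ _ assms] by (auto simp: convex_closed_segment)
  then show ?thesis
  proof cases
    case 1
    then have "over a b c d = meet a b c d" "over c d a b = 0"
      unfolding over_def meet_def of_bool_eq_iff of_bool_eq_0_iff by (metis less_asym)+
    then show ?thesis by simp
  next
    case 2
    then have "over c d a b = meet a b c d" "over a b c d = 0"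
      unfolding over_def meet_def of_bool_eq_iff of_bool_eq_0_iff by (metis less_asym)+
    then show ?thesis by simp
  qed
qed

text \<open>Whether the shadow of \<open>p\<close> lies in the shadow of the triangle, and whether \<open>p\<close> itself lies under the
triangle.\<close>

definition covers :: "real^3 \<Rightarrow> real^3 \<Rightarrow> real^3 \<Rightarrow> real^3 \<Rightarrow> bit" where
  "covers a b c p = of_bool (\<exists>r\<in>convex hull {a, b, c}. r $ 1 = p $ 1 \<and> r $ 2 = p $ 2)"

definition roofs :: "real^3 \<Rightarrow> real^3 \<Rightarrow> real^3 \<Rightarrow> real^3 \<Rightarrow> bit" where
  "roofs a b c p = of_bool (\<exists>r\<in>convex hull {a, b, c}. r $ 1 = p $ 1 \<and> r $ 2 = p $ 2 \<and> p $ 3 < r $ 3)"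

lemma along_2_affine:
  assumes "u + v + w = 1"
  shows "along a b (u * x + v * y + w * z) $ 2
    = u * along a b x $ 2 + v * along a b y $ 2 + w * along a b z $ 2"
proof -
  define m where "m = (b $ 2 - a $ 2) / (b $ 1 - a $ 1)"
  have e: "along a b x $ 2 = a $ 2 + (x - a $ 1) * m" for x
    by (simp add: along_2 m_def)
  have u: "u = 1 - v - w" using assms by simp
  show ?thesis unfolding e u by (simp add: algebra_simps)
qed

lemma vertical_fill:
  fixes S :: "(real^3) set"
  assumes "convex S" "p \<in> S" "q \<in> S" "p $ 1 = q $ 1" "p $ 2 \<le> y" "y \<le> q $ 2"
  shows "\<exists>r\<in>S. r $ 1 = p $ 1 \<and> r $ 2 = y"
proof (cases "p $ 2 = q $ 2")
  case True then show ?thesis using assms by force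
next
  case False
  define t where "t = (y - p $ 2) / (q $ 2 - p $ 2)"
  have t: "0 \<le> t" "t \<le> 1" "t * (q $ 2 - p $ 2) = y - p $ 2"
    using assms False by (auto simp: t_def)
  have "(1 - t) *\<^sub>R p + t *\<^sub>R q \<in> S" using assms t by (auto intro!: convexD)
  moreover have "((1 - t) *\<^sub>R p + t *\<^sub>R q) $ 1 = p $ 1" using assms(4) by (simp add: algebra_simps)
  moreover have "((1 - t) *\<^sub>R p + t *\<^sub>R q) $ 2 = y" using t(3) by (simp add: algebra_simps)
  ultimately show ?thesis by blast
qed

text \<open>A line parallel to the second axis meets the shadow of a triangle in an interval whose ends lie on two
of its sides; a point of that line lies in the interval iff exactly one of these sides is north of it.\<close>

lemma covers_eq_below:
  assumes g: "generic {a, b, c, p}" and dist: "distinct [a, b, c, p]"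
  shows "below p a b + below p b c + below p a c = covers a b c p"
proof -
  have goal: "below p a b + below p b c + below p a c = covers a b c p"
    if g: "generic {a, b, c, p}" and dist: "distinct [a, b, c, p]"
    and o: "a $ 1 < b $ 1" "b $ 1 < c $ 1" for a b c
  proof -
    let ?H = "convex hull {a, b, c}"
    have ac: "a $ 1 < c $ 1" using o by simp
    \<comment> \<open>Taking \<open>b\<close> as the middle vertex, \<open>e\<close> tells on which side of the long edge \<open>ac\<close> it lies.\<close>
    define e where "e = b $ 2 - along a c (b $ 1) $ 2"
    have ends: "along a b (a $ 1) = a" "along a b (b $ 1) = b" "along b c (b $ 1) = b" "along b c (c $ 1) = c"
       "along a c (a $ 1) = a" "along a c (c $ 1) = c"
      using o by (simp_all add: along_left along_right)
    have e_ab: "c $ 2 - along a b (c $ 1) $ 2 = - ((c $ 1 - a $ 1) / (b $ 1 - a $ 1)) * e"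
      using o by (simp add: e_def along_2 divide_simps) (simp add: algebra_simps)
    have e_bc: "a $ 2 - along b c (a $ 1) $ 2 = - ((c $ 1 - a $ 1) / (c $ 1 - b $ 1)) * e"
      using o by (simp add: e_def along_2 divide_simps) (simp add: algebra_simps)
    have hull: "\<exists>u v w. 0 \<le> u \<and> 0 \<le> v \<and> 0 \<le> w \<and> a $ 1 \<le> p $ 1 \<and> p $ 1 \<le> c $ 1 \<and>
       p $ 2 - along a c (p $ 1) $ 2 = v * e \<and> p $ 2 - along a b (p $ 1) $ 2 = - w * e
       \<and> p $ 2 - along b c (p $ 1) $ 2 = - u * e"
      if r: "r \<in> ?H" "r $ 1 = p $ 1" "r $ 2 = p $ 2" for r
    proof -
      from r(1) obtain u v w where uvw: "0 \<le> u" "0 \<le> v" "0 \<le> w" "u + v + w = 1"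
        "r = u *\<^sub>R a + v *\<^sub>R b + w *\<^sub>R c"
        unfolding convex_hull_3 by auto
      have p1: "p $ 1 = u * a $ 1 + v * b $ 1 + w * c $ 1"
        and p2: "p $ 2 = u * a $ 2 + v * b $ 2 + w * c $ 2"
        using r uvw by auto
      have u: "u = 1 - v - w" using uvw(4) by simp
      have "p $ 1 - a $ 1 = v * (b $ 1 - a $ 1) + w * (c $ 1 - a $ 1)"
        unfolding p1 u by (simp add: algebra_simps)
      moreover have w: "w = 1 - u - v" using uvw(4) by simp
      have "c $ 1 - p $ 1 = u * (c $ 1 - a $ 1) + v * (c $ 1 - b $ 1)"
        unfolding p1 w by (simp add: algebra_simps)
      ultimately have x: "a $ 1 \<le> p $ 1" "p $ 1 \<le> c $ 1"
        using uvw(1-3) o ac by (smt (verit) mult_nonneg_nonneg)+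
      have "p $ 2 - along a c (p $ 1) $ 2 = v * e"
        unfolding p1 p2 along_2_affine[OF uvw(4)] ends e_def by (simp add: algebra_simps)
      moreover have "p $ 2 - along a b (p $ 1) $ 2 = w * (c $ 2 - along a b (c $ 1) $ 2)"
        unfolding p1 p2 along_2_affine[OF uvw(4)] ends by (simp add: algebra_simps)
      then have "p $ 2 - along a b (p $ 1) $ 2 = - (w * ((c $ 1 - a $ 1) / (b $ 1 - a $ 1))) * e"
        unfolding e_ab by (simp only: mult_minus_left mult_minus_right mult.assoc)
      moreover have "p $ 2 - along b c (p $ 1) $ 2 = u * (a $ 2 - along b c (a $ 1) $ 2)"
        unfolding p1 p2 along_2_affine[OF uvw(4)] ends by (simp add: algebra_simps)
      then have "p $ 2 - along b c (p $ 1) $ 2 = - (u * ((c $ 1 - a $ 1) / (c $ 1 - b $ 1))) * e"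
        unfolding e_bc by (simp only: mult_minus_left mult_minus_right mult.assoc)
      moreover have "0 \<le> w * ((c $ 1 - a $ 1) / (b $ 1 - a $ 1))"
        "0 \<le> u * ((c $ 1 - a $ 1) / (c $ 1 - b $ 1))" using uvw o by auto
      ultimately show ?thesis using x uvw(2) by blast
    qed
    have sub: "closed_segment a b \<subseteq> ?H" "closed_segment b c \<subseteq> ?H" "closed_segment a c \<subseteq> ?H"
      unfolding segment_convex_hull by (intro hull_mono; simp)+
    have onto: "\<exists>r\<in>?H. r $ 1 = p $ 1 \<and> r $ 2 = p $ 2"
      if r: "r \<in> ?H" "r' \<in> ?H" "r $ 1 = p $ 1" "r' $ 1 = p $ 1"
        "(r $ 2 \<le> p $ 2 \<and> p $ 2 \<le> r' $ 2) \<or> (r' $ 2 \<le> p $ 2 \<and> p $ 2 \<le> r $ 2)" for r r'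
      using vertical_fill[of ?H r r' "p $ 2"] vertical_fill[of ?H r' r "p $ 2"] r
      by (metis convex_convex_hull)
    have n1: "p $ 1 \<noteq> a $ 1" "p $ 1 \<noteq> b $ 1" "p $ 1 \<noteq> c $ 1"
      using g dist unfolding generic_def inj_on_def by auto
    have n2: "along a b (p $ 1) $ 2 \<noteq> p $ 2" "along b c (p $ 1) $ 2 \<noteq> p $ 2" "along a c (p $ 1) $ 2 \<noteq> p $ 2"
      using g dist unfolding generic_def by auto
    note bl = below_along[OF o(1)] below_along[OF o(2)] below_along[OF ac]
    consider "p $ 1 < a $ 1 \<or> c $ 1 < p $ 1" | "a $ 1 < p $ 1" "p $ 1 < b $ 1" | "b $ 1 < p $ 1" "p $ 1 < c $ 1"
      using n1 by linarith
    then show ?thesis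
    proof cases
      case 1
      then have "covers a b c p = 0" unfolding covers_def using hull by fastforce
      moreover have "below p a b = 0" "below p b c = 0" "below p a c = 0"
        unfolding bl using 1 o by auto
      ultimately show ?thesis by simp
    next
      case 2
      have m: "along a b (p $ 1) \<in> ?H" "along a c (p $ 1) \<in> ?H"
        using 2 o in_segment_along[OF o(1)] in_segment_along[OF ac] sub
        by (smt (verit) along_1 subsetD)+
      have "(\<exists>r\<in>?H. r $ 1 = p $ 1 \<and> r $ 2 = p $ 2) \<longleftrightarrow>
         (p $ 2 < along a b (p $ 1) $ 2) \<noteq> (p $ 2 < along a c (p $ 1) $ 2)" (is "?L \<longleftrightarrow> ?R")
      proof
        assume ?L
        then obtain v w where "0 \<le> v" "0 \<le> w" "p $ 2 - along a c (p $ 1) $ 2 = v * e"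
          "p $ 2 - along a b (p $ 1) $ 2 = - w * e" using hull by blast
        then show ?R using n2 
          by (cases "e \<ge> 0") (smt (verit) mult_nonneg_nonneg mult_nonneg_nonpos mult_minus_left)+
      next
        assume ?R
        then show ?L using onto[OF m] 2 o by (auto simp: along_1)
      qed
      then show ?thesis unfolding bl covers_def using 2 o by (auto simp: add_bit_eq_xor)
    next
      case 3
      have m: "along b c (p $ 1) \<in> ?H" "along a c (p $ 1) \<in> ?H"
        using 3 o in_segment_along[OF o(2)] in_segment_along[OF ac] sub
        by (smt (verit) along_1 subsetD)+
      have "(\<exists>r\<in>?H. r $ 1 = p $ 1 \<and> r $ 2 = p $ 2) \<longleftrightarrow>
         (p $ 2 < along b c (p $ 1) $ 2) \<noteq> (p $ 2 < along a c (p $ 1) $ 2)" (is "?L \<longleftrightarrow> ?R")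
      proof
        assume ?L
        then obtain u v where "0 \<le> v" "0 \<le> u" "p $ 2 - along a c (p $ 1) $ 2 = v * e"
          "p $ 2 - along b c (p $ 1) $ 2 = - u * e" using hull by blast
        then show ?R using n2 
          by (cases "e \<ge> 0") (smt (verit) mult_nonneg_nonneg mult_nonneg_nonpos mult_minus_left)+
      next
        assume ?R
        then show ?L using onto[OF m] 3 o by (auto simp: along_1)
      qed
      then show ?thesis unfolding bl covers_def using 3 o by (auto simp: add_bit_eq_xor)
    qed
  qed
  have perm: "covers a b c p = covers x y z p"  if "{a, b, c} = {x, y, z}" for x y z
    unfolding covers_def that ..
  have n: "a $ 1 \<noteq> b $ 1" "b $ 1 \<noteq> c $ 1" "a $ 1 \<noteq> c $ 1"
    using g dist unfolding generic_def inj_on_def by auto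
  have via: ?thesis if xyz: "{a, b, c} = {x, y, z}" and o: "x $ 1 < y $ 1" "y $ 1 < z $ 1"
    and b: "below p a b + below p b c + below p a c = below p x y + below p y z + below p x z" for x y z
  proof -
    have "{x, y, z, p} = {a, b, c, p}" using xyz by auto
    moreover have "distinct [x, y, z, p]" using o dist xyz by auto
    ultimately show ?thesis using goal[of x y z] g o perm[OF xyz] b by simp
  qed
  note bc = below_commute[of p b a] below_commute[of p c a] below_commute[of p c b]
  consider "a $ 1 < b $ 1" "b $ 1 < c $ 1" | "a $ 1 < c $ 1" "c $ 1 < b $ 1"
    | "b $ 1 < a $ 1" "a $ 1 < c $ 1" | "b $ 1 < c $ 1" "c $ 1 < a $ 1"
    | "c $ 1 < a $ 1" "a $ 1 < b $ 1" | "c $ 1 < b $ 1" "b $ 1 < a $ 1" using n by linarith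
  then show ?thesis
  proof cases
    case 1 show ?thesis
      by (rule via[of a b c, OF _ 1]) (simp_all only: bc add.commute add.left_commute insert_commute)
  next
    case 2 show ?thesis
      by (rule via[of a c b, OF _ 2]) (simp_all only: bc add.commute add.left_commute insert_commute)
  next
    case 3 show ?thesis
      by (rule via[of b a c, OF _ 3]) (simp_all only: bc add.commute add.left_commute insert_commute)
  next
    case 4 show ?thesis
      by (rule via[of b c a, OF _ 4]) (simp_all only: bc add.commute add.left_commute insert_commute)
  next
    case 5 show ?thesis
      by (rule via[of c a b, OF _ 5]) (simp_all only: bc add.commute add.left_commute insert_commute)
  next
    case 6 show ?thesis
      by (rule via[of c b a, OF _ 6]) (simp_all only: bc add.commute add.left_commute insert_commute)
  qed
qed

text \<open>This is the local reason why linking numbers are homotopy invariants. Above the shadow of the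
triangle, a segment that misses the triangle is all above or all below it. In the first case it never
passes under the boundary; in the second every crossing counts, and the segment crosses the
boundary an even number of times iff its ends are both inside or both outside the shadow.\<close>

lemma over_triangle:
  assumes g: "generic {a, b, c, d, e}" and dist: "distinct [a, b, c, d, e]"
    and disj: "convex hull {a, b, c} \<inter> closed_segment d e = {}"
  shows "over a b d e + over b c d e + over a c d e = roofs a b c d + roofs a b c e"
proof -
  let ?H = "convex hull {a, b, c}"
  have sub: "closed_segment a b \<subseteq> ?H" "closed_segment b c \<subseteq> ?H" "closed_segment a c \<subseteq> ?H"
    unfolding segment_convex_hull by (intro hull_mono; simp)+
  have de: "d \<in> closed_segment d e" "e \<in> closed_segment d e" by auto
  consider "\<forall>p\<in>?H. \<forall>q\<in>closed_segment d e. p $ 1 = q $ 1 \<and> p $ 2 = q $ 2 \<longrightarrow> q $ 3 < p $ 3"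
    | "\<forall>p\<in>?H. \<forall>q\<in>closed_segment d e. p $ 1 = q $ 1 \<and> p $ 2 = q $ 2 \<longrightarrow> p $ 3 < q $ 3"
    using vertical_order[OF _ _ disj] by (auto simp: convex_closed_segment)
  then show ?thesis
  proof cases
    case 1
    have o: "over x y d e = meet x y d e" if "closed_segment x y \<subseteq> ?H" for x y
      unfolding over_def meet_def of_bool_eq_iff using 1 that by blast
    have r: "roofs a b c p = covers a b c p" if "p \<in> closed_segment d e" for p
      unfolding roofs_def covers_def of_bool_eq_iff using 1 that by blast
    have g': "generic {a, b, d, e}" "generic {b, c, d, e}" "generic {a, c, d, e}"
      "generic {a, b, c, d}" "generic {a, b, c, e}"
      by (rule generic_subset[OF g]; auto)+
    have d4: "distinct [a, b, d, e]" "distinct [b, c, d, e]" "distinct [a, c, d, e]"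
      "distinct [a, b, c, d]" "distinct [a, b, c, e]" using dist by auto
    note m = planar_crossing[OF g'(1) d4(1)] planar_crossing[OF g'(2) d4(2)] planar_crossing[OF g'(3) d4(3)]
    note c = covers_eq_below[OF g'(4) d4(4), symmetric] covers_eq_below[OF g'(5) d4(5), symmetric]
    show ?thesis unfolding o[OF sub(1)] o[OF sub(2)] o[OF sub(3)] r[OF de(1)] r[OF de(2)] m c
      by (simp add: ac_simps)
  next
    case 2
    have "over x y d e = 0" if "closed_segment x y \<subseteq> ?H" for x y
      unfolding over_def of_bool_eq_0_iff using 2 that by (meson less_asym subsetD)
    moreover have "roofs a b c p = 0" if "p \<in> closed_segment d e" for p
      unfolding roofs_def of_bool_eq_0_iff using 2 that by (meson less_asym)
    ultimately show ?thesis using sub de by simp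
  qed
qed

section \<open>General position by small perturbations\<close>

lemma collinear_swap:
  assumes "a $ 1 \<noteq> b $ 1" "a $ 1 \<noteq> c $ 1" "along a b (c $ 1) $ 2 = c $ 2"
  shows "along a c (b $ 1) $ 2 = b $ 2"
proof -
  have "c $ 2 - a $ 2 = ((c $ 1 - a $ 1) / (b $ 1 - a $ 1)) * (b $ 2 - a $ 2)"
    using assms(3) by (simp add: along_2)
  then show ?thesis using assms(1,2) by (simp add: along_2)
qed

lemma generic_insert:
  assumes g: "generic S" and x: "\<And>a. a \<in> S \<Longrightarrow> x $ 1 \<noteq> a $ 1"
    and xab: "\<And>a b. a \<in> S \<Longrightarrow> b \<in> S \<Longrightarrow> a \<noteq> b \<Longrightarrow> along a b (x $ 1) $ 2 \<noteq> x $ 2"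
  shows "generic (insert x S)"
  unfolding generic_def
proof (intro conjI ballI impI)
  have inj: "inj_on (\<lambda>p. p $ 1) S" using g by (simp add: generic_def)
  show "inj_on (\<lambda>p. p $ 1) (insert x S)" using inj x by (auto simp: inj_on_insert)
  fix a b c assume abc: "a \<in> insert x S" "b \<in> insert x S" "c \<in> insert x S" "a \<noteq> b \<and> a \<noteq> c \<and> b \<noteq> c"
  have ne: "p $ 1 \<noteq> q $ 1" if "p \<in> insert x S" "q \<in> insert x S" "p \<noteq> q" for p q
    using that x inj unfolding inj_on_def by (metis insert_iff)
  consider "c = x" "a \<in> S" "b \<in> S" | "b = x" "a \<in> S" "c \<in> S" | "a = x" "b \<in> S" "c \<in> S"
    | "a \<in> S" "b \<in> S" "c \<in> S" using abc by auto
  then show "along a b (c $ 1) $ 2 \<noteq> c $ 2"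
  proof cases
    case 1 then show ?thesis using xab abc by simp
  next
    case 2 then show ?thesis using xab[of a c] collinear_swap[of a b c] ne abc by metis
  next
    case 3
    have "along a b (c $ 1) = along b a (c $ 1)" using along_commute ne abc by metis
    then show ?thesis using 3 xab[of b c] collinear_swap[of b a c] ne abc by metis
  next
    case 4 then show ?thesis using g abc unfolding generic_def by blast
  qed
qed

text \<open>A point spoils general position only on finitely many vertical planes, a null set.\<close>

lemma generic_perturbation_point:
  assumes "finite S" "generic S" "\<epsilon> > 0"
  shows "\<exists>y. dist y x < \<epsilon> \<and> y \<notin> S \<and> generic (insert y S)"
proof -
  define H where "H a b = {y :: real^3. (axis 2 1 - ((b $ 2 - a $ 2) / (b $ 1 - a $ 1)) *\<^sub>R axis 1 1) \<bullet> y
     = a $ 2 - a $ 1 * ((b $ 2 - a $ 2) / (b $ 1 - a $ 1))}" for a b :: "real^3"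
  let ?B = "(\<Union>a\<in>S. {y. axis 1 1 \<bullet> y = a $ 1}) \<union> (\<Union>a\<in>S. \<Union>b\<in>S. H a b)"
  have "negligible (H a b)" for a b
  proof -
    have "(axis 2 1 - ((b $ 2 - a $ 2) / (b $ 1 - a $ 1)) *\<^sub>R axis 1 1 :: real^3) $ 2 = 1"
      by (simp add: axis_def)
    then have "axis 2 1 - ((b $ 2 - a $ 2) / (b $ 1 - a $ 1)) *\<^sub>R axis 1 1 \<noteq> (0 :: real^3)"
      by (metis zero_index zero_neq_one)
    then show ?thesis unfolding H_def by (intro negligible_hyperplane) auto
  qed
  moreover have "negligible {y :: real^3. axis 1 1 \<bullet> y = k}" for k
    by (intro negligible_hyperplane) (simp add: axis_eq_0_iff)
  ultimately have "negligible ?B"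
    using assms(1) by (intro negligible_Un negligible_Union) auto
  moreover have "\<not> negligible (ball x \<epsilon>)" using assms(3) open_not_negligible[of "ball x \<epsilon>"] by auto
  ultimately obtain y where y: "y \<in> ball x \<epsilon>" "y \<notin> ?B"
    by (meson negligible_subset subsetI)
  have y1: "y $ 1 \<noteq> a $ 1" if "a \<in> S" for a
    using y(2) that by (auto simp: inner_axis')
  have "generic (insert y S)"
  proof (rule generic_insert[OF assms(2) y1])
    fix a b assume ab: "a \<in> S" "b \<in> S" "a \<noteq> b"
    define k where "k = (b $ 2 - a $ 2) / (b $ 1 - a $ 1)"
    have "y \<notin> H a b" using y(2) ab by blast
    then have "y $ 2 - k * y $ 1 \<noteq> a $ 2 - a $ 1 * k"
      unfolding H_def k_def by (simp add: inner_axis' inner_diff_left)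
    moreover have "along a b (y $ 1) $ 2 = a $ 2 + (y $ 1 - a $ 1) * k"
      by (simp add: along_2 k_def)
    ultimately show "along a b (y $ 1) $ 2 \<noteq> y $ 2" by (simp add: algebra_simps)
  qed
  then show ?thesis using y y1 by (metis dist_commute mem_ball)
qed

lemma generic_perturbation:
  fixes X :: "'i \<Rightarrow> real^3"
  assumes "finite I" "finite S" "generic S" "\<epsilon> > 0"
  shows "\<exists>Y. inj_on Y I \<and> Y ` I \<inter> S = {} \<and> generic (Y ` I \<union> S) \<and> (\<forall>i\<in>I. dist (Y i) (X i) < \<epsilon>)"
  using assms(1)
proof induction
  case empty
  then show ?case using assms by auto
next
  case (insert k I)
  then obtain Y where Y: "inj_on Y I" "Y ` I \<inter> S = {}" "generic (Y ` I \<union> S)" "\<forall>i\<in>I. dist (Y i) (X i) < \<epsilon>"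
    by blast
  obtain y where y: "dist y (X k) < \<epsilon>" "y \<notin> Y ` I \<union> S" "generic (insert y (Y ` I \<union> S))"
    using generic_perturbation_point[of "Y ` I \<union> S" \<epsilon> "X k"] Y insert assms by auto
  let ?Y = "Y(k := y)"
  have im: "?Y ` I = Y ` I" using insert(2) by auto
  show ?case
  proof (intro exI[of _ ?Y] conjI)
    show "inj_on ?Y (insert k I)" using Y(1) y(2) insert(2) by (auto simp: inj_on_def)
    show "?Y ` insert k I \<inter> S = {}" unfolding image_insert im using Y(2) y(2) by auto
    show "generic (?Y ` insert k I \<union> S)" unfolding image_insert im using y(3) by simp
    show "\<forall>i\<in>insert k I. dist (?Y i) (X i) < \<epsilon>" using Y(4) y(1) by auto
  qed
qed

section \<open>Crossings of polygonal paths mod 2\<close>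

text \<open>Consecutive values cancel mod 2, so a sum along a polygonal path sees only its two ends.\<close>

lemma bit_telescope: "(\<Sum>i<n. F i + F (Suc i)) = F 0 + (F n :: bit)"
proof (induction n)
  case 0
  show ?case by simp
next
  case (Suc n)
  have "(\<Sum>i<Suc n. F i + F (Suc i)) = (F 0 + F n) + (F n + F (Suc n))"
    by (simp only: sum.lessThan_Suc Suc.IH)
  also have "\<dots> = F 0 + F (Suc n)" by (simp only: add.assoc bit_add_self)
  finally show ?case .
qed

text \<open>The parity of the number of crossings at which the polygonal path \<open>P\<close> passes over \<open>Q\<close>.\<close>

definition crossings :: "nat \<Rightarrow> (nat \<Rightarrow> real^3) \<Rightarrow> nat \<Rightarrow> (nat \<Rightarrow> real^3) \<Rightarrow> bit" where
  "crossings n P m Q = (\<Sum>i<n. \<Sum>j<m. over (P i) (P (Suc i)) (Q j) (Q (Suc j)))"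

definition below_path :: "real^3 \<Rightarrow> nat \<Rightarrow> (nat \<Rightarrow> real^3) \<Rightarrow> bit" where
  "below_path p m Q = (\<Sum>j<m. below p (Q j) (Q (Suc j)))"

text \<open>The left side is the parity of all crossings of the two shadows. Summing the formula for two
segments over all pairs of segments, everything telescopes to the ends of the paths.\<close>

lemma crossings_swap:
  assumes g: "generic (P ` {..n} \<union> Q ` {..m})"
    and inj: "inj_on P {..n}" "inj_on Q {..m}" "P ` {..n} \<inter> Q ` {..m} = {}"
    and disj: "\<And>i j. i < n \<Longrightarrow> j < m \<Longrightarrow>
      closed_segment (P i) (P (Suc i)) \<inter> closed_segment (Q j) (Q (Suc j)) = {}"
  shows "crossings n P m Q + crossings m Q n P =
    below_path (P 0) m Q + below_path (P n) m Q + below_path (Q 0) n P + below_path (Q m) n P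
    + (west (P 0) (Q 0) + west (P 0) (Q m) + west (P n) (Q 0) + west (P n) (Q m))"
proof -
  let ?w = "\<lambda>i j. west (P i) (Q j)"
  have cell: "over (P i) (P (Suc i)) (Q j) (Q (Suc j)) + over (Q j) (Q (Suc j)) (P i) (P (Suc i))
    = (below (P i) (Q j) (Q (Suc j)) + below (P (Suc i)) (Q j) (Q (Suc j)))
    + (below (Q j) (P i) (P (Suc i)) + below (Q (Suc j)) (P i) (P (Suc i)))
    + ((?w i j + ?w i (Suc j)) + (?w (Suc i) j + ?w (Suc i) (Suc j)))"
    if ij: "i < n" "j < m" for i j
  proof -
    have "P i \<noteq> P (Suc i)" "Q j \<noteq> Q (Suc j)"
      using inj_onD[OF inj(1), of i "Suc i"] inj_onD[OF inj(2), of j "Suc j"] ij by auto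
    moreover have "P k \<noteq> Q l" if "k \<in> {i, Suc i}" "l \<in> {j, Suc j}" for k l
    proof -
      have "P k \<in> P ` {..n}" "Q l \<in> Q ` {..m}" using ij that by auto
      then show ?thesis using inj(3) by (metis disjoint_iff)
    qed
    ultimately have "distinct [P i, P (Suc i), Q j, Q (Suc j)]" by auto
    moreover have "generic {P i, P (Suc i), Q j, Q (Suc j)}"
      by (rule generic_subset[OF g]) (use ij in auto)
    ultimately show ?thesis
      unfolding over_add_over[OF disj[OF ij]] by (subst planar_crossing) (auto simp: ac_simps)
  qed
  have "crossings n P m Q + crossings m Q n P = 
    (\<Sum>i<n. \<Sum>j<m. over (P i) (P (Suc i)) (Q j) (Q (Suc j)) + over (Q j) (Q (Suc j)) (P i) (P (Suc i)))"
    unfolding crossings_def sum.distrib by (simp add: sum.swap[of _ "{..<n}" "{..<m}"])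
  also have "\<dots> = (\<Sum>i<n. \<Sum>j<m. below (P i) (Q j) (Q (Suc j)) + below (P (Suc i)) (Q j) (Q (Suc j)))
      + (\<Sum>i<n. \<Sum>j<m. below (Q j) (P i) (P (Suc i)) + below (Q (Suc j)) (P i) (P (Suc i)))
      + (\<Sum>i<n. \<Sum>j<m. (?w i j + ?w i (Suc j)) + (?w (Suc i) j + ?w (Suc i) (Suc j)))"
    by (simp add: cell sum.distrib[symmetric])
  also have "(\<Sum>i<n. \<Sum>j<m. below (P i) (Q j) (Q (Suc j)) + below (P (Suc i)) (Q j) (Q (Suc j)))
    = below_path (P 0) m Q + below_path (P n) m Q"
    using bit_telescope[of "\<lambda>i. below_path (P i) m Q" n] unfolding below_path_def sum.distrib by simp
  also have "(\<Sum>i<n. \<Sum>j<m. below (Q j) (P i) (P (Suc i)) + below (Q (Suc j)) (P i) (P (Suc i)))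
    = (\<Sum>i<n. below (Q 0) (P i) (P (Suc i)) + below (Q m) (P i) (P (Suc i)))"
    by (simp only: bit_telescope[of "\<lambda>j. below (Q j) _ _" m])
  also have "\<dots> = below_path (Q 0) n P + below_path (Q m) n P"
    unfolding below_path_def sum.distrib ..
  also have "(\<Sum>i<n. \<Sum>j<m. (?w i j + ?w i (Suc j)) + (?w (Suc i) j + ?w (Suc i) (Suc j)))
    = (\<Sum>i<n. (?w i 0 + ?w i m) + (?w (Suc i) 0 + ?w (Suc i) m))"
  proof (intro sum.cong refl)
    fix i
    show "(\<Sum>j<m. (?w i j + ?w i (Suc j)) + (?w (Suc i) j + ?w (Suc i) (Suc j)))
      = (?w i 0 + ?w i m) + (?w (Suc i) 0 + ?w (Suc i) m)"
      using bit_telescope[of "?w i" m] bit_telescope[of "?w (Suc i)" m]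
      by (simp only: sum.distrib[of "\<lambda>j. ?w i j + ?w i (Suc j)" "\<lambda>j. ?w (Suc i) j + ?w (Suc i) (Suc j)"])
  qed
  also have "\<dots> = (?w 0 0 + ?w 0 m) + (?w n 0 + ?w n m)"
    by (rule bit_telescope)
  finally show ?thesis by (simp only: ac_simps)
qed

text \<open>If \<open>L\<close> sums to zero around each small triangle of a grid, moving the closed chain \<open>c\<close> from one row of
the grid to the next changes its \<open>L\<close>-value only by the sides of the strips, and these cancel because
every vertex is an end of an even number of edges. The last row is coned off from the point \<open>x\<close>.\<close>

lemma grid_contraction:
  fixes L :: "'p \<Rightarrow> 'p \<Rightarrow> bit" and Z :: "'e \<Rightarrow> nat \<Rightarrow> nat \<Rightarrow> 'p"
  assumes sym: "\<And>x y. L x y = L y x"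
    and closed: "\<And>F :: 'v \<Rightarrow> bit. (\<Sum>e\<in>c. F (t e) + F (h e)) = 0"
    and side: "\<And>e j. e \<in> c \<Longrightarrow> Z e 0 j = Y (t e) j" "\<And>e j. e \<in> c \<Longrightarrow> Z e n j = Y (h e) j"
    and tri: "\<And>e i j. e \<in> c \<Longrightarrow> i < n \<Longrightarrow> j < m \<Longrightarrow>
       L (Z e i j) (Z e (Suc i) j) + L (Z e (Suc i) j) (Z e i (Suc j)) + L (Z e i j) (Z e i (Suc j)) = 0"
      "\<And>e i j. e \<in> c \<Longrightarrow> i < n \<Longrightarrow> j < m \<Longrightarrow>
       L (Z e (Suc i) j) (Z e i (Suc j)) + L (Z e i (Suc j)) (Z e (Suc i) (Suc j))
         + L (Z e (Suc i) j) (Z e (Suc i) (Suc j)) = 0"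
    and cone: "\<And>e i. e \<in> c \<Longrightarrow> i < n \<Longrightarrow> L x (Z e i m) + L (Z e i m) (Z e (Suc i) m) + L x (Z e (Suc i) m) = 0"
  shows "(\<Sum>e\<in>c. \<Sum>i<n. L (Z e i 0) (Z e (Suc i) 0)) = 0"
proof -
  define row where "row j = (\<Sum>e\<in>c. \<Sum>i<n. L (Z e i j) (Z e (Suc i) j))" for j
  have eq: "a = b" if "a + b = 0" for a b :: bit using that by (cases a; cases b) auto
  have cancel1: "a = p + q" if "p + a + q = 0" for a p q :: bit
    using that by (cases a; cases p; cases q) auto
  have step: "row j + row (Suc j) = 0" if j: "j < m" for j
  proof -
    have "row j + row (Suc j) = 
      (\<Sum>e\<in>c. \<Sum>i<n. L (Z e i j) (Z e (Suc i) j) + L (Z e i (Suc j)) (Z e (Suc i) (Suc j)))"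
      by (simp add: row_def sum.distrib)
    also have "\<dots> = (\<Sum>e\<in>c. \<Sum>i<n. L (Z e i j) (Z e i (Suc j)) + L (Z e (Suc i) j) (Z e (Suc i) (Suc j)))"
    proof (intro sum.cong refl)
      fix e i assume ei: "e \<in> c" "i \<in> {..<n}"
      have cancel: "a + b = p + q" if "a + d + p = 0" "d + b + q = 0" for a b d p q :: bit
        using that by (cases a; cases b; cases d; cases p; cases q) auto
      show "L (Z e i j) (Z e (Suc i) j) + L (Z e i (Suc j)) (Z e (Suc i) (Suc j))
          = L (Z e i j) (Z e i (Suc j)) + L (Z e (Suc i) j) (Z e (Suc i) (Suc j))"
        by (rule cancel[OF tri(1) tri(2)]) (use ei j in auto)
    qed
    also have "\<dots> = (\<Sum>e\<in>c. L (Z e 0 j) (Z e 0 (Suc j)) + L (Z e n j) (Z e n (Suc j)))"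
      by (intro sum.cong refl bit_telescope)
    also have "\<dots> = (\<Sum>e\<in>c. L (Y (t e) j) (Y (t e) (Suc j)) + L (Y (h e) j) (Y (h e) (Suc j)))"
      using side by (intro sum.cong) auto
    also have "\<dots> = 0" by (rule closed)
    finally show ?thesis .
  qed
  have "row 0 = row j" if "j \<le> m" for j
    using that
  proof (induction j)
    case (Suc j)
    then show ?case using eq[OF step, of j] by (metis Suc_leD Suc_le_lessD)
  qed simp
  then have "row 0 = row m" by simp
  also have "row m = (\<Sum>e\<in>c. \<Sum>i<n. L x (Z e i m) + L x (Z e (Suc i) m))"
    unfolding row_def
  proof (intro sum.cong refl)
    fix e i assume "e \<in> c" "i \<in> {..<n}"
    then have "L x (Z e i m) + L (Z e i m) (Z e (Suc i) m) + L x (Z e (Suc i) m) = 0" using cone by simp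
    then show "L (Z e i m) (Z e (Suc i) m) = L x (Z e i m) + L x (Z e (Suc i) m)"
      by (rule cancel1)
  qed
  also have "\<dots> = (\<Sum>e\<in>c. L x (Z e 0 m) + L x (Z e n m))"
    by (intro sum.cong refl bit_telescope)
  also have "\<dots> = (\<Sum>e\<in>c. L x (Y (t e) m) + L x (Y (h e) m))"
    using side by (intro sum.cong) auto
  also have "\<dots> = 0" by (rule closed)
  finally show ?thesis by (simp add: row_def)
qed

section \<open>Polygonal approximations and their linking numbers\<close>

text \<open>A finite loopfree graph with vertices \<open>V\<close>, edges \<open>A\<close>, tails \<open>t\<close> and heads \<open>h\<close>, mapped continuously
to space.\<close>

locale graph_map =
  fixes V :: "'v set" and A :: "'e set" and t h :: "'e \<Rightarrow> 'v"
    and pos :: "'v \<Rightarrow> real^3" and \<gamma> :: "'e \<Rightarrow> real \<Rightarrow> real^3"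
  assumes finite_V: "finite V" and finite_A: "finite A"
    and ends_V: "e \<in> A \<Longrightarrow> t e \<in> V" "e \<in> A \<Longrightarrow> h e \<in> V"
    and no_loop: "e \<in> A \<Longrightarrow> t e \<noteq> h e"
    and path_\<gamma>: "e \<in> A \<Longrightarrow> path (\<gamma> e)"
    and start_\<gamma>: "e \<in> A \<Longrightarrow> pathstart (\<gamma> e) = pos (t e)"
    and finish_\<gamma>: "e \<in> A \<Longrightarrow> pathfinish (\<gamma> e) = pos (h e)"
begin

text \<open>Each edge is cut into \<open>n\<close> pieces of equal parameter length; the edges at a vertex share the node
\<open>Inl v\<close>. A sample moves the images of the nodes by less than \<open>1 / n\<close> into general position.\<close>

definition node :: "nat \<Rightarrow> 'e \<Rightarrow> nat \<Rightarrow> 'v + 'e \<times> nat" where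
  "node n e i = (if i = 0 then Inl (t e) else if i = n then Inl (h e) else Inr (e, i))"

definition nodes :: "nat \<Rightarrow> ('v + 'e \<times> nat) set" where
  "nodes n = Inl ` V \<union> Inr ` (A \<times> {0<..<n})"

definition place :: "nat \<Rightarrow> 'v + 'e \<times> nat \<Rightarrow> real^3" where
  "place n k = (case k of Inl v \<Rightarrow> pos v | Inr (e, i) \<Rightarrow> \<gamma> e (real i / real n))"

definition sample :: "nat \<Rightarrow> ('v + 'e \<times> nat \<Rightarrow> real^3) \<Rightarrow> bool" where
  "sample n Y \<longleftrightarrow> inj_on Y (nodes n) \<and> generic (Y ` nodes n) \<and>
     (\<forall>k\<in>nodes n. dist (Y k) (place n k) < 1 / real n)"

abbreviation poly :: "nat \<Rightarrow> ('v + 'e \<times> nat \<Rightarrow> real^3) \<Rightarrow> 'e \<Rightarrow> nat \<Rightarrow> real^3" where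
  "poly n Y e i \<equiv> Y (node n e i)"

text \<open>The mod 2 cycles of the graph: testing against all functions \<open>F\<close> says that every vertex is an end of
an even number of edges of \<open>c\<close>.\<close>

definition closed_chain :: "'e set \<Rightarrow> bool" where
  "closed_chain c \<longleftrightarrow> c \<subseteq> A \<and> (\<forall>F :: 'v \<Rightarrow> bit. (\<Sum>e\<in>c. F (t e) + F (h e)) = 0)"

text \<open>The mod 2 linking number of the polygonal approximations of two disjoint closed chains, computed from
the diagram as the parity of the crossings at which the first is over the second.\<close>

definition link :: "nat \<Rightarrow> ('v + 'e \<times> nat \<Rightarrow> real^3) \<Rightarrow> 'e set \<Rightarrow> 'e set \<Rightarrow> bit" where
  "link n Y c d = (\<Sum>e\<in>c. \<Sum>f\<in>d. crossings n (poly n Y e) n (poly n Y f))"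

lemma finite_nodes: "finite (nodes n)"
  using finite_V finite_A by (simp add: nodes_def)

lemma node_in_nodes: "e \<in> A \<Longrightarrow> i \<le> n \<Longrightarrow> node n e i \<in> nodes n"
  using ends_V by (auto simp: node_def nodes_def)

lemma place_node: "e \<in> A \<Longrightarrow> i \<le> n \<Longrightarrow> 0 < n \<Longrightarrow> place n (node n e i) = \<gamma> e (real i / real n)"
  using start_\<gamma>[of e] finish_\<gamma>[of e]
  by (auto simp: place_def node_def pathstart_def pathfinish_def)

lemma node_inj: "e \<in> A \<Longrightarrow> 0 < n \<Longrightarrow> inj_on (node n e) {..n}"
  using no_loop[of e] by (auto simp: inj_on_def node_def split: if_splits)

lemma node_disjoint:
  "{t e, h e} \<inter> {t f, h f} = {} \<Longrightarrow> node n e i \<noteq> node n f j"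
  by (auto simp: node_def)

lemma sample_exists: "0 < n \<Longrightarrow> \<exists>Y. sample n Y"
  using generic_perturbation[OF finite_nodes[of n], of "{}" "1 / real n" "place n"]
  by (simp add: sample_def generic_def)

lemma sample_dist:
  "sample n Y \<Longrightarrow> e \<in> A \<Longrightarrow> i \<le> n \<Longrightarrow> 0 < n \<Longrightarrow> dist (poly n Y e i) (\<gamma> e (real i / real n)) < 1 / real n"
  unfolding sample_def using node_in_nodes place_node by metis

lemma param_in: "i \<le> n \<Longrightarrow> real i / real n \<in> {0..1}"
  by (cases "n = 0") auto

lemma eventually_mesh:
  assumes "0 < \<delta>"
  shows "\<forall>\<^sub>F n in sequentially. \<forall>e\<in>A. \<forall>i<n. dist (\<gamma> e (real i / real n)) (\<gamma> e (real (Suc i) / real n)) < \<delta>"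
proof (intro eventually_ball_finite finite_A ballI)
  fix e assume "e \<in> A"
  then have "uniformly_continuous_on {0..1} (\<gamma> e)"
    using path_\<gamma> by (auto simp: path_def intro: compact_uniformly_continuous)
  then obtain \<eta> where \<eta>: "0 < \<eta>" "\<And>x y. x \<in> {0..1} \<Longrightarrow> y \<in> {0..1} \<Longrightarrow> dist y x < \<eta> \<Longrightarrow> dist (\<gamma> e y) (\<gamma> e x) < \<delta>"
    using assms unfolding uniformly_continuous_on_def by blast
  have "\<forall>\<^sub>F n in sequentially. 1 / real n < \<eta>"
    using \<eta>(1) by real_asymp
  then show "\<forall>\<^sub>F n in sequentially. \<forall>i<n. dist (\<gamma> e (real i / real n)) (\<gamma> e (real (Suc i) / real n)) < \<delta>"
  proof eventually_elim
    case (elim n)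
    show ?case
    proof (intro allI impI)
      fix i assume i: "i < n"
      have "real i / real n - real (Suc i) / real n = - (1 / real n)"
        by (simp add: diff_divide_distrib[symmetric])
      then have "dist (real i / real n) (real (Suc i) / real n) < \<eta>"
        using elim by (simp add: dist_real_def)
      then show "dist (\<gamma> e (real i / real n)) (\<gamma> e (real (Suc i) / real n)) < \<delta>"
        by (intro \<eta>(2) param_in) (use i in auto)
    qed
  qed
qed

lemma eventually_segments:
  assumes "0 < \<delta>"
  shows "\<forall>\<^sub>F n in sequentially. \<forall>Y. sample n Y \<longrightarrow> (\<forall>e\<in>A. \<forall>i<n.
    closed_segment (poly n Y e i) (poly n Y e (Suc i)) \<subseteq> ball (\<gamma> e (real i / real n)) \<delta>)"
proof -
  have "\<forall>\<^sub>F n in sequentially. 1 / real n < \<delta> / 2"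
    using assms by real_asymp
  moreover have "\<forall>\<^sub>F n in sequentially. \<forall>e\<in>A. \<forall>i<n. dist (\<gamma> e (real i / real n)) (\<gamma> e (real (Suc i) / real n)) < \<delta> / 2"
    using assms by (intro eventually_mesh) simp
  ultimately show ?thesis
  proof eventually_elim
    case (elim n)
    show ?case
    proof (intro allI impI ballI)
      fix Y e i assume Y: "sample n Y" and e: "e \<in> A" and i: "i < n"
      have "dist (\<gamma> e (real i / real n)) (poly n Y e i) < \<delta>"
        using sample_dist[OF Y e, of i] i elim(1) assms by (simp add: dist_commute)
      moreover have "dist (\<gamma> e (real i / real n)) (poly n Y e (Suc i)) < \<delta>"
        using dist_triangle[of "\<gamma> e (real i / real n)" "poly n Y e (Suc i)" "\<gamma> e (real (Suc i) / real n)"]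
          sample_dist[OF Y e, of "Suc i"] i elim e by (fastforce simp: dist_commute)
      ultimately show "closed_segment (poly n Y e i) (poly n Y e (Suc i)) \<subseteq> ball (\<gamma> e (real i / real n)) \<delta>"
        by (intro closed_segment_subset) auto
    qed
  qed
qed

lemma path_image_param: "i \<le> n \<Longrightarrow> \<gamma> e (real i / real n) \<in> path_image (\<gamma> e)"
  unfolding path_image_def using param_in by blast

lemma eventually_disjoint_segments:
  assumes ef: "e \<in> A" "f \<in> A" and disj: "path_image (\<gamma> e) \<inter> path_image (\<gamma> f) = {}"
  shows "\<forall>\<^sub>F n in sequentially. \<forall>Y. sample n Y \<longrightarrow> (\<forall>i<n. \<forall>j<n.
    closed_segment (poly n Y e i) (poly n Y e (Suc i)) \<inter> closed_segment (poly n Y f j) (poly n Y f (Suc j)) = {})"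
proof -
  obtain \<delta> where \<delta>: "0 < \<delta>" "\<And>x y. x \<in> path_image (\<gamma> e) \<Longrightarrow> y \<in> path_image (\<gamma> f) \<Longrightarrow> \<delta> \<le> dist x y"
    using separate_compact_closed[OF compact_path_image[OF path_\<gamma>[OF ef(1)]]
      compact_imp_closed[OF compact_path_image[OF path_\<gamma>[OF ef(2)]]] disj] by blast
  have "\<forall>\<^sub>F n in sequentially. \<forall>Y. sample n Y \<longrightarrow> (\<forall>e\<in>A. \<forall>i<n.
    closed_segment (poly n Y e i) (poly n Y e (Suc i)) \<subseteq> ball (\<gamma> e (real i / real n)) (\<delta> / 2))"
    using \<delta>(1) by (intro eventually_segments) simp
  then show ?thesis
  proof eventually_elim
    case (elim n)
    show ?case
    proof (intro allI impI)
      fix Y i j assume Y: "sample n Y" and ij: "i < n" "j < n"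
      have "ball (\<gamma> e (real i / real n)) (\<delta> / 2) \<inter> ball (\<gamma> f (real j / real n)) (\<delta> / 2) = {}"
        using \<delta>(2)[of "\<gamma> e (real i / real n)" "\<gamma> f (real j / real n)"] path_image_param ij
        by (intro disjoint_ballI) auto
      then show "closed_segment (poly n Y e i) (poly n Y e (Suc i)) \<inter>
          closed_segment (poly n Y f j) (poly n Y f (Suc j)) = {}"
        using elim Y ef ij by blast
    qed
  qed
qed

lemma sample_crossings_swap:
  assumes Y: "sample n Y" and n: "0 < n" and ef: "e \<in> A" "f \<in> A"
    and ends: "{t e, h e} \<inter> {t f, h f} = {}"
    and disj: "\<And>i j. i < n \<Longrightarrow> j < n \<Longrightarrow>
      closed_segment (poly n Y e i) (poly n Y e (Suc i)) \<inter> closed_segment (poly n Y f j) (poly n Y f (Suc j)) = {}"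
  shows "crossings n (poly n Y e) n (poly n Y f) + crossings n (poly n Y f) n (poly n Y e) =
    below_path (Y (Inl (t e))) n (poly n Y f) + below_path (Y (Inl (h e))) n (poly n Y f)
    + below_path (Y (Inl (t f))) n (poly n Y e) + below_path (Y (Inl (h f))) n (poly n Y e)
    + (west (Y (Inl (t e))) (Y (Inl (t f))) + west (Y (Inl (t e))) (Y (Inl (h f)))
      + west (Y (Inl (h e))) (Y (Inl (t f))) + west (Y (Inl (h e))) (Y (Inl (h f))))"
proof -
  have e: "node n g 0 = Inl (t g)" "node n g n = Inl (h g)" for g using n by (auto simp: node_def)
  have sub: "node n g ` {..n} \<subseteq> nodes n" if "g \<in> A" for g using node_in_nodes that by auto
  have injY: "inj_on Y (nodes n)" using Y by (simp add: sample_def)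
  have im: "(\<lambda>i. Y (node n g i)) ` {..n} = Y ` (node n g ` {..n})" for g by auto
  have inj: "inj_on (\<lambda>i. Y (node n g i)) {..n}" if "g \<in> A" for g
    using comp_inj_on[OF node_inj[OF that n] inj_on_subset[OF injY sub[OF that]]] by (simp add: comp_def)
  have "node n e ` {..n} \<inter> node n f ` {..n} = {}" using node_disjoint[OF ends] by auto
  then have "(\<lambda>i. Y (node n e i)) ` {..n} \<inter> (\<lambda>i. Y (node n f i)) ` {..n} = {}"
    unfolding im using inj_on_image_Int[OF injY sub[OF ef(1)] sub[OF ef(2)]] by simp
  moreover have "generic ((\<lambda>i. Y (node n e i)) ` {..n} \<union> (\<lambda>i. Y (node n f i)) ` {..n})"
    using Y sub[OF ef(1)] sub[OF ef(2)] unfolding im sample_def by (blast intro: generic_subset)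
  ultimately show ?thesis
    using crossings_swap[of "poly n Y e" n "poly n Y f" n] inj ef disj unfolding e by blast
qed

text \<open>The two numbers differ by the parity of the crossings of two closed curves in the plane. By the
formula for single edges this is a sum over the ends of edges, hence zero on closed chains.\<close>

lemma link_swap:
  assumes Y: "sample n Y" and n: "0 < n" and cd: "closed_chain c" "closed_chain d"
    and ends: "(t ` c \<union> h ` c) \<inter> (t ` d \<union> h ` d) = {}"
    and disj: "\<And>e f i j. e \<in> c \<Longrightarrow> f \<in> d \<Longrightarrow> i < n \<Longrightarrow> j < n \<Longrightarrow>
      closed_segment (poly n Y e i) (poly n Y e (Suc i)) \<inter> closed_segment (poly n Y f j) (poly n Y f (Suc j)) = {}"
  shows "link n Y d c = link n Y c d"
proof -
  let ?B = "\<lambda>v f. below_path (Y (Inl v)) n (poly n Y f)" and ?w = "\<lambda>u v. west (Y (Inl u)) (Y (Inl v))"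
  have cA: "c \<subseteq> A" "d \<subseteq> A" using cd by (auto simp: closed_chain_def)
  have z: "(\<Sum>e\<in>c. F (t e) + F (h e)) = 0" "(\<Sum>e\<in>d. F (t e) + F (h e)) = 0" for F :: "'v \<Rightarrow> bit"
    using cd by (auto simp: closed_chain_def)
  have "link n Y c d + link n Y d c =
    (\<Sum>e\<in>c. \<Sum>f\<in>d. crossings n (poly n Y e) n (poly n Y f) + crossings n (poly n Y f) n (poly n Y e))"
    unfolding link_def sum.distrib by (simp add: sum.swap[of _ d c])
  also have "\<dots> = (\<Sum>e\<in>c. \<Sum>f\<in>d. (?B (t e) f + ?B (h e) f)
      + ((?B (t f) e + ?w (t e) (t f) + ?w (h e) (t f)) + (?B (h f) e + ?w (t e) (h f) + ?w (h e) (h f))))"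
  proof (intro sum.cong refl)
    fix e f assume ef: "e \<in> c" "f \<in> d"
    then have "{t e, h e} \<inter> {t f, h f} = {}" using ends by blast
    then show "crossings n (poly n Y e) n (poly n Y f) + crossings n (poly n Y f) n (poly n Y e) =
       (?B (t e) f + ?B (h e) f)
      + ((?B (t f) e + ?w (t e) (t f) + ?w (h e) (t f)) + (?B (h f) e + ?w (t e) (h f) + ?w (h e) (h f)))"
      using sample_crossings_swap[OF Y n _ _ _ disj[OF ef]] ef cA
      by (simp only: subset_eq ac_simps)
  qed
  also have "\<dots> = (\<Sum>e\<in>c. (\<Sum>f\<in>d. ?B (t e) f) + (\<Sum>f\<in>d. ?B (h e) f))
     + (\<Sum>e\<in>c. \<Sum>f\<in>d. (?B (t f) e + ?w (t e) (t f) + ?w (h e) (t f)) + (?B (h f) e + ?w (t e) (h f) + ?w (h e) (h f)))"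
    unfolding sum.distrib[of "\<lambda>f. ?B _ f + ?B _ f"] sum.distrib[of "\<lambda>f. ?B _ f"]
    by (simp only: sum.distrib[of _ _ c])
  also have "(\<Sum>e\<in>c. (\<Sum>f\<in>d. ?B (t e) f) + (\<Sum>f\<in>d. ?B (h e) f)) = 0"
    by (rule z(1))
  also have "(\<Sum>e\<in>c. \<Sum>f\<in>d. (?B (t f) e + ?w (t e) (t f) + ?w (h e) (t f))
      + (?B (h f) e + ?w (t e) (h f) + ?w (h e) (h f))) = 0"
    by (intro sum.neutral ballI z(2))
  finally have "link n Y c d + link n Y d c = 0" by simp
  then show ?thesis by (cases "link n Y c d"; cases "link n Y d c") auto
qed


text \<open>If \<open>c\<close> contracts in a set that misses \<open>d\<close>, the contraction, evaluated on a fine grid and moved into general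
position together with the given sample, sweeps \<open>c\<close> to a point through small triangles. These stay
within half the distance between the swept set and \<open>d\<close>, hence miss the polygonal approximation of
\<open>d\<close>, and \<open>over_triangle\<close> makes each of them contribute zero.\<close>

lemma contracted_link_zero:
  fixes C :: "real \<times> (real^3) \<Rightarrow> real^3"
  assumes cd: "closed_chain c" "closed_chain d"
    and ends: "(t ` c \<union> h ` c) \<inter> (t ` d \<union> h ` d) = {}"
    and c_in: "\<And>e. e \<in> c \<Longrightarrow> path_image (\<gamma> e) \<subseteq> U"
    and d_out: "\<And>f. f \<in> d \<Longrightarrow> path_image (\<gamma> f) \<inter> U = {}"
    and C: "continuous_on ({0..1} \<times> U) C" "C ` ({0..1} \<times> U) \<subseteq> U"
      "\<And>x. x \<in> U \<Longrightarrow> C (0, x) = x" "\<And>x. x \<in> U \<Longrightarrow> C (1, x) = a"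
  shows "\<forall>\<^sub>F n in sequentially. \<forall>Y. sample n Y \<longrightarrow> link n Y c d = 0"
proof -
  have cA: "c \<subseteq> A" "d \<subseteq> A" using cd by (auto simp: closed_chain_def)
  have fin: "finite c" "finite d" using cA finite_A finite_subset by auto
  have z: "(\<Sum>e\<in>c. F (t e) + F (h e)) = 0" "(\<Sum>e\<in>d. F (t e) + F (h e)) = 0" for F :: "'v \<Rightarrow> bit"
    using cd by (auto simp: closed_chain_def)
  define J where "J = (\<Union>e\<in>c. path_image (\<gamma> e))"
  define K where "K = (\<Union>f\<in>d. path_image (\<gamma> f))"
  define T where "T = C ` ({0..1} \<times> J)"
  have cpt: "compact J" "compact K" unfolding J_def K_def
    using fin cA by (auto intro!: compact_UN compact_path_image path_\<gamma>)
  have JU: "J \<subseteq> U" using c_in by (auto simp: J_def)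
  have contJ: "continuous_on ({0..1} \<times> J) C"
    using JU by (intro continuous_on_subset[OF C(1)]) auto
  have cJ: "compact ({0..1::real} \<times> J)" using compact_Times[OF compact_Icc cpt(1)] .
  have "compact T" unfolding T_def by (intro compact_continuous_image contJ cJ)
  moreover have "T \<subseteq> U" using C(2) JU by (auto simp: T_def)
  then have "T \<inter> K = {}" using d_out by (auto simp: K_def)
  ultimately obtain \<delta> where \<delta>: "0 < \<delta>" "\<And>x y. x \<in> T \<Longrightarrow> y \<in> K \<Longrightarrow> \<delta> \<le> dist x y"
    using separate_compact_closed[of T K] compact_imp_closed[OF cpt(2)] by blast
  have "uniformly_continuous_on ({0..1} \<times> J) C"
    by (intro compact_uniformly_continuous contJ cJ)
  then obtain \<eta> where \<eta>: "0 < \<eta>"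
    "\<And>p q. p \<in> {0..1} \<times> J \<Longrightarrow> q \<in> {0..1} \<times> J \<Longrightarrow> dist q p < \<eta> \<Longrightarrow> dist (C q) (C p) < \<delta> / 8"
    unfolding uniformly_continuous_on_def using \<delta>(1) by (metis zero_less_divide_iff zero_less_numeral)
  obtain m :: nat where m: "0 < m" "1 / real m < \<eta> / 2"
    using \<eta>(1) by (metis half_gt_zero nat_approx_posE inverse_eq_divide zero_less_Suc)
  have "\<forall>\<^sub>F n in sequentially. \<forall>e\<in>A. \<forall>i<n. dist (\<gamma> e (real i / real n)) (\<gamma> e (real (Suc i) / real n)) < \<eta> / 2"
    using \<eta>(1) by (intro eventually_mesh) simp
  moreover have "\<forall>\<^sub>F n in sequentially. \<forall>Y. sample n Y \<longrightarrow> (\<forall>e\<in>A. \<forall>i<n.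
    closed_segment (poly n Y e i) (poly n Y e (Suc i)) \<subseteq> ball (\<gamma> e (real i / real n)) (\<delta> / 2))"
    using \<delta>(1) by (intro eventually_segments) simp
  moreover have "\<forall>\<^sub>F n in sequentially. 1 / real n < \<delta> / 8" using \<delta>(1) by real_asymp
  moreover have "\<forall>\<^sub>F n in sequentially. 0 < n" by (rule eventually_gt_at_top)
  ultimately show ?thesis
  proof eventually_elim
    case (elim n)
    note mesh = elim(1) and segs = elim(2) and small = elim(3) and n = elim(4)
    show ?case
    proof (intro allI impI)
      fix Y assume Y: "sample n Y"
      \<comment> \<open>The new points: \<open>None\<close> is the apex of the final cone, \<open>Some (k, j)\<close> is the node \<open>k\<close> at time \<open>j / m\<close>; at time \<open>0\<close> the grid reuses the points of the sample.\<close>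
      define I where "I = insert None (Some ` (nodes n \<times> {1..m}))"
      define X where "X k = (case k of None \<Rightarrow> a | Some (k, j) \<Rightarrow> C (real j / real m, place n k))" for k
      have "finite I" "finite (Y ` nodes n)" by (auto simp: I_def finite_nodes)
      moreover have genY: "generic (Y ` nodes n)" and injY: "inj_on Y (nodes n)"
        using Y by (auto simp: sample_def)
      ultimately obtain Y' where Y': "inj_on Y' I" "Y' ` I \<inter> Y ` nodes n = {}"
          "generic (Y' ` I \<union> Y ` nodes n)" "\<forall>k\<in>I. dist (Y' k) (X k) < \<delta> / 8"
        using generic_perturbation[of I "Y ` nodes n" "\<delta> / 8" X] \<delta>(1) by auto
      define D where "D = insert None (Some ` (nodes n \<times> {0..m}))"
      define Q where "Q k = (case k of Some (l, 0) \<Rightarrow> Y l | _ \<Rightarrow> Y' k)" for k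
      have Q0: "Q (Some (l, 0)) = Y l" for l by (simp add: Q_def)
      have QI: "Q k = Y' k" if "k \<in> I" for k using that by (auto simp: Q_def I_def split: nat.split)
      have D_eq: "D = I \<union> (\<lambda>l. Some (l, 0)) ` nodes n" by (force simp: D_def I_def)
      have "inj_on Q D"
        unfolding D_eq
      proof (rule inj_on_Un[THEN iffD2], intro conjI)
        show "inj_on Q I" using Y'(1) QI by (simp add: inj_on_def)
        show "inj_on Q ((\<lambda>l. Some (l, 0)) ` nodes n)" using injY Q0 by (auto simp: inj_on_def)
        have "Q ` I = Y' ` I" "Q ` (\<lambda>l. Some (l, 0)) ` nodes n = Y ` nodes n"
          using QI Q0 by (auto simp: image_image)
        then show "Q ` (I - (\<lambda>l. Some (l, 0)) ` nodes n) \<inter> Q ` ((\<lambda>l. Some (l, 0)) ` nodes n - I) = {}"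
          using Y'(2) by blast
      qed
      moreover have genQ: "generic (Q ` D)"
        by (rule generic_subset[OF Y'(3)]) (use QI Q0 in \<open>auto simp: D_eq\<close>)
      ultimately have Q_eq: "Q k = Q l \<longleftrightarrow> k = l" if "k \<in> D" "l \<in> D" for k l
        using that by (simp add: inj_on_eq_iff)
      have near: "dist (Q (Some (node n e i, j))) (C (real j / real m, \<gamma> e (real i / real n))) < \<delta> / 8"
        if "e \<in> c" "i \<le> n" "j \<le> m" for e i j
      proof (cases "j = 0")
        case True
        have "\<gamma> e (real i / real n) \<in> U" using path_image_param[of i n e] c_in that by auto
        then show ?thesis using True sample_dist[OF Y, of e i] that cA small n C(3) Q0 by force
      next
        case False
        then have "Some (node n e i, j) \<in> I" using that node_in_nodes cA by (auto simp: I_def)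
        then have "dist (Q (Some (node n e i, j))) (X (Some (node n e i, j))) < \<delta> / 8"
          using Y'(4) QI by simp
        then show ?thesis using place_node[of e i n] that cA n by (auto simp: X_def)
      qed
      define L where "L x y = (\<Sum>f\<in>d. \<Sum>j<n. over x y (poly n Y f j) (poly n Y f (Suc j)))" for x y
      \<comment> \<open>The grid points on the contracted side; they differ from all points on \<open>d\<close>.\<close>
      define E where "E = insert None (\<Union>e\<in>c. range (\<lambda>(i, j). Some (node n e i, j :: nat)))"
      have inE: "None \<in> E" "e \<in> c \<Longrightarrow> Some (node n e i, j) \<in> E" for e i j
        by (force simp: E_def)+
      have off: "k \<noteq> Some (node n f j, 0)" if "f \<in> d" "k \<in> E" for k f j
      proof -
        have "node n f j \<noteq> node n e i" if "e \<in> c" for e i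
          by (rule node_disjoint) (use that \<open>f \<in> d\<close> ends in blast)
        then show ?thesis using that by (auto simp: E_def)
      qed
      have triangle: "L (Q k) (Q l) + L (Q l) (Q r) + L (Q k) (Q r) = 0"
        if klr: "k \<noteq> l" "l \<noteq> r" "k \<noteq> r" "{k, l, r} \<subseteq> D"
          "{k, l, r} \<subseteq> E"
          and w: "w \<in> T" "{Q k, Q l, Q r} \<subseteq> ball w (\<delta> / 2)" for k l r w
      proof -
        let ?R = "roofs (Q k) (Q l) (Q r)"
        have "over (Q k) (Q l) (poly n Y f j) (poly n Y f (Suc j)) + over (Q l) (Q r) (poly n Y f j) (poly n Y f (Suc j))
            + over (Q k) (Q r) (poly n Y f j) (poly n Y f (Suc j)) = ?R (poly n Y f j) + ?R (poly n Y f (Suc j))"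
          if f: "f \<in> d" and j: "j < n" for f j
        proof (rule over_triangle)
          have nd: "Some (node n f i, 0) \<in> D" if "i \<le> n" for i
            using node_in_nodes[of f i n] f cA that by (auto simp: D_def)
          have ne: "Some (node n f j, 0::nat) \<noteq> Some (node n f (Suc j), 0)"
            using inj_onD[OF node_inj, of f n j "Suc j"] f cA n j by auto
          have pq: "poly n Y f i = Q (Some (node n f i, 0))" for i by (simp add: Q0)
          have "distinct [k, l, r, Some (node n f j, 0), Some (node n f (Suc j), 0)]"
            using klr off[OF f] ne by auto
          then show "distinct [Q k, Q l, Q r, poly n Y f j, poly n Y f (Suc j)]"
            unfolding pq using klr(4) nd[of j] nd[of "Suc j"] j by (simp add: Q_eq)
          show "generic {Q k, Q l, Q r, poly n Y f j, poly n Y f (Suc j)}"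
            unfolding pq by (rule generic_subset[OF genQ]) (use klr(4) nd j in auto)
          have "convex hull {Q k, Q l, Q r} \<subseteq> ball w (\<delta> / 2)"
            using w(2) by (intro hull_minimal convex_ball)
          moreover have "closed_segment (poly n Y f j) (poly n Y f (Suc j)) \<subseteq> ball (\<gamma> f (real j / real n)) (\<delta> / 2)"
            using segs Y f j cA by blast
          moreover have "\<gamma> f (real j / real n) \<in> K" using path_image_param[of j n f] f j by (auto simp: K_def)
          then have "ball w (\<delta> / 2) \<inter> ball (\<gamma> f (real j / real n)) (\<delta> / 2) = {}"
            using \<delta>(2)[OF w(1)] by (intro disjoint_ballI) auto
          ultimately show "convex hull {Q k, Q l, Q r} \<inter> closed_segment (poly n Y f j) (poly n Y f (Suc j)) = {}"
            by blast
        qed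
        then have "L (Q k) (Q l) + L (Q l) (Q r) + L (Q k) (Q r)
            = (\<Sum>f\<in>d. \<Sum>j<n. ?R (poly n Y f j) + ?R (poly n Y f (Suc j)))"
          unfolding L_def sum.distrib[symmetric] by (intro sum.cong refl) simp
        also have "\<dots> = (\<Sum>f\<in>d. ?R (poly n Y f 0) + ?R (poly n Y f n))"
          by (intro sum.cong refl bit_telescope)
        also have "\<dots> = (\<Sum>f\<in>d. ?R (Y (Inl (t f))) + ?R (Y (Inl (h f))))"
          using n by (simp add: node_def)
        also have "\<dots> = 0" by (rule z(2))
        finally show ?thesis .
      qed
      have param: "\<gamma> e (real i / real n) \<in> J" if "e \<in> c" "i \<le> n" for e i
        using path_image_param[of i n e] that by (auto simp: J_def)
      have inT: "C (real j / real m, \<gamma> e (real i / real n)) \<in> T" if "e \<in> c" "i \<le> n" "j \<le> m" for e i j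
        using param[OF that(1,2)] param_in[OF that(3)] by (auto simp: T_def)
      have close: "Q (Some (node n e i', j')) \<in> ball (C (real j / real m, \<gamma> e (real i / real n))) (\<delta> / 2)"
        if e: "e \<in> c" and ij: "i < n" "j < m" and ij': "i' \<in> {i, Suc i}" "j' \<in> {j, Suc j}" for e i j i' j'
      proof -
        have le: "i' \<le> n" "j' \<le> m" using ij ij' by auto
        have "dist (real j' / real m) (real j / real m) < \<eta> / 2"
        proof -
          have "real (Suc j) / real m - real j / real m = 1 / real m"
            by (simp add: diff_divide_distrib[symmetric])
          then show ?thesis using ij'(2) m \<eta>(1) by (auto simp: dist_real_def)
        qed
        moreover have "dist (\<gamma> e (real i' / real n)) (\<gamma> e (real i / real n)) < \<eta> / 2"
          using mesh e cA ij ij'(1) \<eta>(1) by (auto simp: dist_commute)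
        ultimately have "dist (real j' / real m, \<gamma> e (real i' / real n)) (real j / real m, \<gamma> e (real i / real n)) < \<eta>"
          unfolding dist_Pair_Pair using sqrt_sum_squares_le_sum[of "dist (real j' / real m) (real j / real m)"]
          by (smt (verit, best) field_sum_of_halves zero_le_dist)
        then have "dist (C (real j' / real m, \<gamma> e (real i' / real n))) (C (real j / real m, \<gamma> e (real i / real n))) < \<delta> / 8"
          using param[OF e, of i] param[OF e, of i'] param_in[of j m] param_in[of j' m] le ij
          by (intro \<eta>(2)) auto
        moreover have "dist (Q (Some (node n e i', j'))) (C (real j' / real m, \<gamma> e (real i' / real n))) < \<delta> / 8"
          using e ij ij' by (intro near) auto
        ultimately have "dist (Q (Some (node n e i', j'))) (C (real j / real m, \<gamma> e (real i / real n))) < \<delta> / 8 + \<delta> / 8"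
          by (meson add_strict_mono dist_triangle_lt dist_triangle order_le_less_trans)
        then show ?thesis using \<delta>(1) by (simp add: dist_commute)
      qed
      have inD: "Some (node n e i, j) \<in> D" if "e \<in> c" "i \<le> n" "j \<le> m" for e i j
        using that node_in_nodes cA by (auto simp: D_def)
      have ne: "node n e i \<noteq> node n e (Suc i)" if "e \<in> c" "i < n" for e i
        using inj_onD[OF node_inj, of e n i "Suc i"] that cA n by auto
      have "(\<Sum>e\<in>c. \<Sum>i<n. L (Q (Some (node n e i, 0))) (Q (Some (node n e (Suc i), 0)))) = 0"
      proof (rule grid_contraction[where L = L and t = t and h = h and m = m and x = "Q None"
            and Z = "\<lambda>e i j. Q (Some (node n e i, j))" and Y = "\<lambda>v j. Q (Some (Inl v, j))"])
        show "L x y = L y x" for x y unfolding L_def by (simp add: over_commute(1))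
        show "(\<Sum>e\<in>c. F (t e) + F (h e)) = 0" for F :: "'v \<Rightarrow> bit" by (rule z(1))
        show "Q (Some (node n e 0, j)) = Q (Some (Inl (t e), j))"
          "Q (Some (node n e n, j)) = Q (Some (Inl (h e), j))" for e j
          using n by (auto simp: node_def)
      next
        fix e i j assume eij: "e \<in> c" "i < n" "j < m"
        let ?w = "C (real j / real m, \<gamma> e (real i / real n))"
        have w: "?w \<in> T" using eij by (intro inT) auto
        show "L (Q (Some (node n e i, j))) (Q (Some (node n e (Suc i), j)))
          + L (Q (Some (node n e (Suc i), j))) (Q (Some (node n e i, Suc j)))
          + L (Q (Some (node n e i, j))) (Q (Some (node n e i, Suc j))) = 0"
          by (rule triangle[OF _ _ _ _ _ w]) (use eij ne close inD inE in auto)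
        show "L (Q (Some (node n e (Suc i), j))) (Q (Some (node n e i, Suc j)))
          + L (Q (Some (node n e i, Suc j))) (Q (Some (node n e (Suc i), Suc j)))
          + L (Q (Some (node n e (Suc i), j))) (Q (Some (node n e (Suc i), Suc j))) = 0"
          by (rule triangle[OF _ _ _ _ _ w]) (use eij ne close inD inE in auto)
      next
        fix e i assume ei: "e \<in> c" "i < n"
        have aw: "C (real m / real m, \<gamma> e (real i' / real n)) = a" if "i' \<le> n" for i'
          using C(4) param[OF ei(1) that] JU m(1) by auto
        have "a \<in> T" using inT[OF ei(1), of i m] aw[of i] ei by auto
        moreover have "Q (Some (node n e i', m)) \<in> ball a (\<delta> / 2)" if "i' \<le> n" for i'
          using near[OF ei(1) that, of m] aw[OF that] \<delta>(1) by (simp add: dist_commute)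
        moreover have "Q None \<in> ball a (\<delta> / 2)"
          using Y'(4) QI[of None] \<delta>(1) by (auto simp: I_def X_def dist_commute)
        ultimately show "L (Q None) (Q (Some (node n e i, m)))
          + L (Q (Some (node n e i, m))) (Q (Some (node n e (Suc i), m)))
          + L (Q None) (Q (Some (node n e (Suc i), m))) = 0"
          using ei ne inE inD[OF ei(1), of i m] inD[OF ei(1), of "Suc i" m]
          by (intro triangle[of _ _ _ a]) (auto simp: D_def)
      qed
      then have "(\<Sum>e\<in>c. \<Sum>i<n. L (poly n Y e i) (poly n Y e (Suc i))) = 0"
        unfolding Q0 .
      moreover have "(\<Sum>i<n. L (poly n Y e i) (poly n Y e (Suc i)))
         = (\<Sum>f\<in>d. crossings n (poly n Y e) n (poly n Y f))" for e
        unfolding L_def crossings_def by (rule sum.swap)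
      ultimately show "link n Y c d = 0" by (simp add: link_def)
    qed
  qed
qed

end

section \<open>The sides of a split link\<close>

text \<open>Central projection from the origin identifies the open hemisphere with an affine hyperplane.\<close>

lemma contractible_hemisphere:
  assumes s: "s \<in> {1, -1 :: real}"
  shows "contractible {x \<in> S3. 0 < s * x $ 1}" (is "contractible ?W")
proof -
  let ?H = "{y :: real^4. y $ 1 = s}"
  have ss: "s * s = 1" "s \<noteq> 0" using s by auto
  have "convex ?H"
    by (rule convexI) (use ss in \<open>auto simp: distrib_right[symmetric]\<close>)
  moreover have "?H homeomorphic ?W"
  proof (rule homeomorphicI[where f = "\<lambda>y. y /\<^sub>R norm y" and g = "\<lambda>x. x /\<^sub>R (s * x $ 1)"])
    have nz: "0 < norm y" if "y \<in> ?H" for y using that ss by auto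
    show c: "continuous_on ?H (\<lambda>y. y /\<^sub>R norm y)"
      using nz by (intro continuous_intros) auto
    show "continuous_on ?W (\<lambda>x. x /\<^sub>R (s * x $ 1))"
      by (intro continuous_intros) auto
    have fW: "y /\<^sub>R norm y \<in> ?W" if "y \<in> ?H" for y
    proof -
      have "s * (y /\<^sub>R norm y) $ 1 = inverse (norm y)" using that ss by (simp add: mult.left_commute[of s])
      then have "0 < s * (y /\<^sub>R norm y) $ 1" using nz[OF that] by (simp only: positive_imp_inverse_positive)
      moreover have "y /\<^sub>R norm y \<in> S3" using nz[OF that] by simp
      ultimately show ?thesis by blast
    qed
    have gH: "x /\<^sub>R (s * x $ 1) \<in> ?H" if "x \<in> ?W" for x
      using that ss by (auto simp: field_simps)
    show gf: "(y /\<^sub>R norm y) /\<^sub>R (s * (y /\<^sub>R norm y) $ 1) = y" if "y \<in> ?H" for y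
      using that nz[OF that] ss by (auto simp: field_simps)
    show fg: "(x /\<^sub>R (s * x $ 1)) /\<^sub>R norm (x /\<^sub>R (s * x $ 1)) = x" if "x \<in> ?W" for x
    proof -
      define r where "r = s * x $ 1"
      have r: "norm x = 1" "0 < r" using that by (auto simp: r_def)
      then have "norm (x /\<^sub>R r) = inverse r" by simp
      then show ?thesis unfolding r_def[symmetric] using r by simp
    qed
    show "(\<lambda>y. y /\<^sub>R norm y) ` ?H = ?W" using fW gH fg by (metis (no_types, lifting) image_subsetI subsetI image_eqI subset_antisym)
    show "(\<lambda>x. x /\<^sub>R (s * x $ 1)) ` ?W = ?H" using fW gH gf by (metis (no_types, lifting) image_subsetI subsetI image_eqI subset_antisym)
  qed
  ultimately show ?thesis using convex_imp_contractible homeomorphic_contractible by blast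
qed

text \<open>The sides of the splitting sphere are images of open hemispheres. They are disjoint, so one of them
avoids \<open>q\<close>; it contains one of the two curves and misses the other.\<close>

lemma split_link_contractible_side:
  assumes "split_link J K" "q \<in> S3"
  shows "\<exists>W. contractible W \<and> W \<subseteq> S3 - {q} \<and> (J \<subseteq> W \<and> K \<inter> W = {} \<or> K \<subseteq> W \<and> J \<inter> W = {})"
proof -
  obtain F X Y H k where H: "homeomorphism S3 S3 H k" and F: "F = H ` {x \<in> S3. x $ 1 = 0}"
    and XY: "X \<in> components (S3 - F)" "Y \<in> components (S3 - F)" "X \<noteq> Y" and J: "J \<subseteq> X" and K: "K \<subseteq> Y"
    using assms(1) unfolding split_link_def tame_2sphere_def by blast
  define W where "W s = H ` {x \<in> S3. 0 < s * x $ 1}" for s :: real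
  have im: "H ` S3 = S3" and inj: "inj_on H S3"
    using H by (auto simp: homeomorphism_def intro: inj_on_inverseI)
  have cW: "contractible (W s)" if "s \<in> {1, -1}" for s
  proof -
    have "homeomorphism {x \<in> S3. 0 < s * x $ 1} (W s) H k"
      using im by (intro homeomorphism_of_subsets[OF H]) (auto simp: W_def)
    then show ?thesis
      using contractible_hemisphere[OF that] homeomorphic_contractible homeomorphic_def by blast
  qed
  have disj: "W 1 \<inter> W (-1) = {}"
    unfolding W_def using inj_on_image_Int[OF inj, of "{x \<in> S3. 0 < 1 * x $ 1}" "{x \<in> S3. 0 < -1 * x $ 1}"]
    by (auto simp: inj_on_eq_iff[OF inj])
  have cover: "S3 - F = W 1 \<union> W (-1)"
  proof -
    have "S3 - F = H ` (S3 - {x \<in> S3. x $ 1 = 0})"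
      unfolding F by (subst inj_on_image_set_diff[OF inj]) (auto simp: im)
    also have "S3 - {x \<in> S3. x $ 1 = 0} = {x \<in> S3. 0 < 1 * x $ 1} \<union> {x \<in> S3. 0 < -1 * x $ 1}"
      by auto
    finally show ?thesis by (simp only: W_def image_Un)
  qed
  have max: "W s \<subseteq> Z" if "Z \<in> components (S3 - F)" "Z \<inter> W s \<noteq> {}" "s \<in> {1, -1}" for Z s
    using components_maximal[OF that(1) contractible_imp_connected[OF cW[OF that(3)]]] that cover by auto
  have XY0: "X \<inter> Y = {}" using components_nonoverlap[OF XY(1,2)] XY(3) by simp
  have ne: "X \<noteq> {}" "Y \<noteq> {}" "X \<subseteq> W 1 \<union> W (-1)" "Y \<subseteq> W 1 \<union> W (-1)"
    using XY in_components_nonempty in_components_subset cover by blast+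
  have "(X \<subseteq> W 1 \<and> Y \<subseteq> W (-1)) \<or> (X \<subseteq> W (-1) \<and> Y \<subseteq> W 1)"
  proof (cases "X \<inter> W 1 = {}")
    case True
    then have "X \<inter> W (-1) \<noteq> {}" using ne by blast
    then have "W (-1) \<subseteq> X" using max XY by auto
    then show ?thesis using True XY0 ne by blast
  next
    case False
    then have "W 1 \<subseteq> X" using max XY by auto
    then have Y: "Y \<subseteq> W (-1)" using XY0 ne by blast
    then have "W (-1) \<subseteq> Y" using max XY ne by blast
    then show ?thesis using Y XY0 ne by blast
  qed
  moreover have "q \<notin> W 1 \<or> q \<notin> W (-1)" using disj by blast
  moreover have "W 1 \<subseteq> S3" "W (-1) \<subseteq> S3" using cover by auto
  ultimately obtain s where s: "s \<in> {1, -1}" "q \<notin> W s" "W s \<subseteq> S3"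
    and "X \<subseteq> W s \<and> Y \<inter> W s = {} \<or> Y \<subseteq> W s \<and> X \<inter> W s = {}"
    using disj by blast
  then have "J \<subseteq> W s \<and> K \<inter> W s = {} \<or> K \<subseteq> W s \<and> J \<inter> W s = {}" using J K by blast
  then show ?thesis using cW[OF s(1)] s(2,3) by (intro exI[of _ "W s"]) auto
qed

section \<open>Parity certificates for intrinsic linking\<close>

lemma (in wf_digraph) awalk_boundary:
  "awalk u p v \<Longrightarrow> (\<Sum>e\<leftarrow>p. F (tail G e) + F (head G e)) = F u + (F v :: bit)"
proof (induction p arbitrary: u)
  case Nil
  then show ?case by (auto simp: awalk_Nil_iff)
next
  case (Cons e p)
  then show ?case by (auto simp: awalk_Cons_iff add.assoc)
qed

lemma (in wf_digraph) awalk_heads: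
  "awalk u p v \<Longrightarrow> u \<in> insert v (tail G ` set p) \<and> head G ` set p \<subseteq> insert v (tail G ` set p)"
proof (induction p arbitrary: u)
  case Nil
  then show ?case by (auto simp: awalk_Nil_iff)
next
  case (Cons e p)
  then have "u = tail G e" "awalk (head G e) p v" by (auto simp: awalk_Cons_iff)
  then show ?case using Cons.IH[of "head G e"] by auto
qed

lemma (in wf_digraph) cycle_facts:
  assumes "cycle c"
  shows "set c \<subseteq> arcs G" "distinct c" "head G ` set c \<subseteq> tail G ` set c"
    "(\<Sum>e\<in>set c. F (tail G e) + F (head G e)) = (0 :: bit)"
proof -
  obtain u where u: "awalk u c u" "distinct c" "c \<noteq> []" using assms cycle_conv by auto
  show "set c \<subseteq> arcs G" using u by (auto simp: awalk_def)
  show "distinct c" using u by simp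
  obtain e p where c: "c = e # p" using u by (cases c) auto
  then have "u = tail G e" using u by (simp add: awalk_Cons_iff)
  then show "head G ` set c \<subseteq> tail G ` set c" using awalk_heads[OF u(1)] c by auto
  show "(\<Sum>e\<in>set c. F (tail G e) + F (head G e)) = 0"
    using awalk_boundary[OF u(1), of F] u(2) by (simp add: sum_list_distinct_conv_sum_set)
qed

text \<open>The relations that hold between the crossing parities \<open>X\<close> of the edges, the positions \<open>B\<close> of the
vertices relative to the edges, and the order \<open>s\<close> of the vertices, in every generic diagram of a
graph in space.\<close>

definition crossing_law :: "('a, 'b) pre_digraph \<Rightarrow> ('b \<Rightarrow> 'b \<Rightarrow> bit) \<Rightarrow> ('a \<Rightarrow> 'b \<Rightarrow> bit) \<Rightarrow> ('a \<Rightarrow> 'a \<Rightarrow> bit) \<Rightarrow> bool" where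
  "crossing_law G X B s \<longleftrightarrow>
    (\<forall>u\<in>verts G. \<forall>v\<in>verts G. u \<noteq> v \<longrightarrow> s u v + s v u = 1) \<and>
    (\<forall>e\<in>arcs G. \<forall>f\<in>arcs G. {tail G e, head G e} \<inter> {tail G f, head G f} = {} \<longrightarrow>
      X e f + X f e = B (tail G e) f + B (head G e) f + B (tail G f) e + B (head G f) e
       + (s (tail G e) (tail G f) + s (tail G e) (head G f) + s (head G e) (tail G f) + s (head G e) (head G f)))"

text \<open>If all pairs in \<open>P\<close> were split, all their linking numbers would vanish; but on every diagram their sum is
forced to be odd by the crossing law. The complement of a point \<open>q\<close> off the graph serves as
\<open>\<real>\<^sup>3\<close>.\<close>

theorem intrinsically_linked_certificate:
  assumes G: "digraph G"
    and cyc: "\<And>c d. (c, d) \<in> set P \<Longrightarrow> pre_digraph.cycle G c \<and> pre_digraph.cycle G d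
       \<and> tail G ` set c \<inter> tail G ` set d = {}"
    and odd: "\<And>X B s. crossing_law G X B s \<Longrightarrow> (\<Sum>(c, d)\<leftarrow>P. \<Sum>e\<leftarrow>c. \<Sum>f\<leftarrow>d. X e f) = 1"
  shows "intrinsically_linked G"
proof (rule ccontr)
  interpret digraph G by (rule G)
  assume "\<not> intrinsically_linked G"
  then obtain p g where tame: "tame_S3_embedding G p g"
    and split: "\<And>c d. cycle c \<Longrightarrow> cycle d \<Longrightarrow> tail G ` set c \<inter> tail G ` set d = {} \<Longrightarrow>
        split_link (\<Union>e\<in>set c. path_image (g e)) (\<Union>e\<in>set d. path_image (g e))"
    unfolding intrinsically_linked_def by blast
  obtain q h k where q: "q \<in> S3 - embedded_image G p g" and h: "homeomorphism (S3 - {q}) (UNIV :: (real^3) set) h k"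
    and emb: "S3_embedding G p g"
    using tame unfolding tame_S3_embedding_def by blast
  have injp: "inj_on p (verts G)"
    and arcg: "\<And>e. e \<in> arcs G \<Longrightarrow> Path_Connected.arc (g e) \<and> path_image (g e) \<subseteq> S3 \<and>
        pathstart (g e) = p (tail G e) \<and> pathfinish (g e) = p (head G e) \<and>
        path_image (g e) \<inter> p ` verts G = {p (tail G e), p (head G e)}"
    and meet: "\<And>e f. e \<in> arcs G \<Longrightarrow> f \<in> arcs G \<Longrightarrow> e \<noteq> f \<Longrightarrow> path_image (g e) \<inter> path_image (g f) \<subseteq> p ` verts G"
    using emb unfolding S3_embedding_def by blast+
  have gq: "path_image (g e) \<subseteq> S3 - {q}" if "e \<in> arcs G" for e
    using arcg[OF that] q that by (auto simp: embedded_image_def)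
  have conth: "continuous_on (S3 - {q}) h" and injh: "inj_on h (S3 - {q})"
    using h by (auto simp: homeomorphism_def intro: inj_on_inverseI)
  interpret graph_map "verts G" "arcs G" "tail G" "head G" "h \<circ> p" "\<lambda>e. h \<circ> g e"
  proof
    fix e assume e: "e \<in> arcs G"
    show "path (h \<circ> g e)"
      using arcg[OF e] gq[OF e] by (intro path_continuous_image continuous_on_subset[OF conth]) (auto simp: arc_imp_path)
    show "pathstart (h \<circ> g e) = (h \<circ> p) (tail G e)" "pathfinish (h \<circ> g e) = (h \<circ> p) (head G e)"
      using arcg[OF e] by (auto simp: pathstart_compose pathfinish_compose)
  qed (use no_loops in auto)
  have g_disj: "path_image (g e) \<inter> path_image (g f) = {}"
    if ef: "e \<in> arcs G" "f \<in> arcs G" "{tail G e, head G e} \<inter> {tail G f, head G f} = {}" for e f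
  proof -
    have "e \<noteq> f" using ef by auto
    then have m: "path_image (g e) \<inter> path_image (g f) \<subseteq> p ` verts G" using meet ef by blast
    have "path_image (g a) \<inter> p ` verts G = p ` {tail G a, head G a}" if "a \<in> arcs G" for a
      using arcg[OF that] by simp
    with m ef have "path_image (g e) \<inter> path_image (g f) \<subseteq> p ` {tail G e, head G e} \<inter> p ` {tail G f, head G f}"
      by blast
    also have "\<dots> = p ` ({tail G e, head G e} \<inter> {tail G f, head G f})"
      by (rule inj_on_image_Int[OF injp, symmetric]) (simp_all add: ef)
    finally show ?thesis using ef(3) by simp
  qed
  have hg_disj: "path_image (h \<circ> g e) \<inter> path_image (h \<circ> g f) = {}"
    if "e \<in> arcs G" "f \<in> arcs G" "{tail G e, head G e} \<inter> {tail G f, head G f} = {}" for e f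
    unfolding path_image_compose using inj_on_image_Int[OF injh gq gq, of e f] g_disj[OF that] that by simp
  have ev_disj: "\<forall>\<^sub>F n in sequentially. \<forall>e\<in>arcs G. \<forall>f\<in>arcs G. {tail G e, head G e} \<inter> {tail G f, head G f} = {} \<longrightarrow>
      (\<forall>Y. sample n Y \<longrightarrow> (\<forall>i<n. \<forall>j<n. closed_segment (poly n Y e i) (poly n Y e (Suc i)) \<inter>
         closed_segment (poly n Y f j) (poly n Y f (Suc j)) = {}))"
  proof (intro eventually_ball_finite finite_arcs ballI)
    fix e f assume ef: "e \<in> arcs G" "f \<in> arcs G"
    show "\<forall>\<^sub>F n in sequentially. {tail G e, head G e} \<inter> {tail G f, head G f} = {} \<longrightarrow>
      (\<forall>Y. sample n Y \<longrightarrow> (\<forall>i<n. \<forall>j<n. closed_segment (poly n Y e i) (poly n Y e (Suc i)) \<inter>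
         closed_segment (poly n Y f j) (poly n Y f (Suc j)) = {}))"
      by (cases "{tail G e, head G e} \<inter> {tail G f, head G f} = {}")
        (use eventually_disjoint_segments[OF ef] hg_disj[OF ef] in auto)
  qed
  have chain: "closed_chain (set c)" if "cycle c" for c
    using cycle_facts[OF that] by (auto simp: closed_chain_def)
  \<comment> \<open>A contractible set that avoids \<open>q\<close> becomes a contractible subset of \<open>\<real>\<^sup>3\<close>, and a contraction of it contracts every curve in it.\<close>
  have one_side: "\<forall>\<^sub>F n in sequentially. \<forall>Y. sample n Y \<longrightarrow> link n Y (set c) (set d) = 0"
    if c: "cycle c" and d: "cycle d" and tl: "tail G ` set c \<inter> tail G ` set d = {}"
      and W: "contractible W" "W \<subseteq> S3 - {q}"
      and cW: "(\<Union>e\<in>set c. path_image (g e)) \<subseteq> W" and dW: "(\<Union>e\<in>set d. path_image (g e)) \<inter> W = {}" for c d W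
  proof -
    have "homeomorphism W (h ` W) h k"
      using W(2) by (intro homeomorphism_of_subsets[OF h]) auto
    then have "contractible (h ` W)" using W(1) homeomorphic_contractible homeomorphic_def by blast
    then obtain a where "homotopic_with_canon (\<lambda>x. True) (h ` W) (h ` W) id (\<lambda>x. a)"
      by (auto simp: contractible_def)
    then obtain C where C: "continuous_map (top_of_set ({0..1::real} \<times> h ` W)) (top_of_set (h ` W)) C"
        "\<And>x. C (0, x) = x" "\<And>x. C (1, x) = a"
      unfolding homotopic_with_def prod_topology_subtopology_eu id_apply by blast
    then have C': "continuous_on ({0..1} \<times> h ` W) C" "C ` ({0..1} \<times> h ` W) \<subseteq> h ` W"
      unfolding continuous_map_subtopology_eu image_subset_iff_funcset by blast+
    show ?thesis
    proof (rule contracted_link_zero[OF chain[OF c] chain[OF d] _ _ _ C', where a = a])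
      show "(tail G ` set c \<union> head G ` set c) \<inter> (tail G ` set d \<union> head G ` set d) = {}"
        using cycle_facts(3)[OF c] cycle_facts(3)[OF d] tl by blast
      show "path_image (h \<circ> g e) \<subseteq> h ` W" if "e \<in> set c" for e
        unfolding path_image_compose using cW that by blast
      show "path_image (h \<circ> g f) \<inter> h ` W = {}" if "f \<in> set d" for f
      proof -
        have "f \<in> arcs G" using cycle_facts(1)[OF d] that by auto
        then show ?thesis unfolding path_image_compose
          using inj_on_image_Int[OF injh gq W(2), of f] dW that by auto
      qed
    qed (simp_all add: C)
  qed
  have link0: "\<forall>\<^sub>F n in sequentially. \<forall>Y. sample n Y \<longrightarrow> link n Y (set c) (set d) = 0"
    if cd: "(c, d) \<in> set P" for c d
  proof -
    have c: "cycle c" and d: "cycle d" and tl: "tail G ` set c \<inter> tail G ` set d = {}" using cyc[OF cd] by auto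
    obtain W where W: "contractible W" "W \<subseteq> S3 - {q}" and
      side: "(\<Union>e\<in>set c. path_image (g e)) \<subseteq> W \<and> (\<Union>e\<in>set d. path_image (g e)) \<inter> W = {} \<or>
        (\<Union>e\<in>set d. path_image (g e)) \<subseteq> W \<and> (\<Union>e\<in>set c. path_image (g e)) \<inter> W = {}"
      using split_link_contractible_side[OF split[OF c d tl], of q] q by auto
    from side show ?thesis
    proof
      assume "(\<Union>e\<in>set c. path_image (g e)) \<subseteq> W \<and> (\<Union>e\<in>set d. path_image (g e)) \<inter> W = {}"
      then show ?thesis using one_side[OF c d tl W] by simp
    next
      assume "(\<Union>e\<in>set d. path_image (g e)) \<subseteq> W \<and> (\<Union>e\<in>set c. path_image (g e)) \<inter> W = {}"
      then have "\<forall>\<^sub>F n in sequentially. \<forall>Y. sample n Y \<longrightarrow> link n Y (set d) (set c) = 0"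
        using one_side[OF d c _ W] tl by blast
      moreover have "\<forall>\<^sub>F n in sequentially. 0 < n" by (rule eventually_gt_at_top)
      ultimately show ?thesis using ev_disj
      proof eventually_elim
        case (elim n)
        show ?case
        proof (intro allI impI)
          fix Y assume Y: "sample n Y"
          have sub: "set c \<subseteq> arcs G" "set d \<subseteq> arcs G" using cycle_facts(1) c d by auto
          have vd: "(tail G ` set d \<union> head G ` set d) \<inter> (tail G ` set c \<union> head G ` set c) = {}"
            using cycle_facts(3)[OF c] cycle_facts(3)[OF d] tl by blast
          have "link n Y (set c) (set d) = link n Y (set d) (set c)"
          proof (rule link_swap[OF Y elim(2) chain[OF d] chain[OF c] vd])
            fix e f i j assume *: "e \<in> set d" "f \<in> set c" "i < n" "j < n"
            then have "{tail G e, head G e} \<inter> {tail G f, head G f} = {}" using vd by blast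
            then show "closed_segment (poly n Y e i) (poly n Y e (Suc i)) \<inter>
                closed_segment (poly n Y f j) (poly n Y f (Suc j)) = {}"
              using elim(3) * sub Y by blast
          qed
          then show "link n Y (set c) (set d) = 0" using elim(1) Y by simp
        qed
      qed
    qed
  qed
  have "\<forall>\<^sub>F n in sequentially. \<forall>cd\<in>set P. \<forall>Y. sample n Y \<longrightarrow> link n Y (set (fst cd)) (set (snd cd)) = 0"
    by (intro eventually_ball_finite) (auto intro: link0)
  moreover have "\<forall>\<^sub>F n in sequentially. 0 < n" by (rule eventually_gt_at_top)
  ultimately have "\<forall>\<^sub>F n in sequentially. False"
    using ev_disj
  proof eventually_elim
    case (elim n)
    obtain Y where Y: "sample n Y" using sample_exists elim(2) by blast
    let ?O = "\<lambda>e f. crossings n (poly n Y e) n (poly n Y f)"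
    let ?B = "\<lambda>v f. below_path (Y (Inl v)) n (poly n Y f)"
    let ?s = "\<lambda>u v. west (Y (Inl u)) (Y (Inl v))"
    have "crossing_law G ?O ?B ?s"
      unfolding crossing_law_def
    proof (intro conjI ballI impI)
      fix u v assume uv: "u \<in> verts G" "v \<in> verts G" "u \<noteq> v"
      then have N: "Inl u \<in> nodes n" "Inl v \<in> nodes n" by (simp_all add: nodes_def)
      then have "Y (Inl u) \<noteq> Y (Inl v)"
        using Y uv(3) inj_onD[of Y "nodes n" "Inl u" "Inl v"] by (auto simp: sample_def)
      moreover have "inj_on (\<lambda>x. x $ 1) (Y ` nodes n)" using Y by (simp add: sample_def generic_def)
      ultimately have "Y (Inl u) $ 1 \<noteq> Y (Inl v) $ 1"
        using N inj_onD[of "\<lambda>x. x $ 1" "Y ` nodes n" "Y (Inl u)" "Y (Inl v)"] by blast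
      then show "?s u v + ?s v u = 1" by (auto simp: west_def)
    next
      fix e f assume ef: "e \<in> arcs G" "f \<in> arcs G" "{tail G e, head G e} \<inter> {tail G f, head G f} = {}"
      have "\<forall>i<n. \<forall>j<n. closed_segment (poly n Y e i) (poly n Y e (Suc i)) \<inter>
          closed_segment (poly n Y f j) (poly n Y f (Suc j)) = {}"
        using elim(3) ef Y by blast
      then show "?O e f + ?O f e = ?B (tail G e) f + ?B (head G e) f + ?B (tail G f) e + ?B (head G f) e
         + (?s (tail G e) (tail G f) + ?s (tail G e) (head G f) + ?s (head G e) (tail G f) + ?s (head G e) (head G f))"
        by (intro sample_crossings_swap[OF Y elim(2) ef]) simp
    qed
    then have "(\<Sum>(c, d)\<leftarrow>P. \<Sum>e\<leftarrow>c. \<Sum>f\<leftarrow>d. ?O e f) = 1" by (rule odd)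
    moreover have "(\<Sum>e\<leftarrow>c. \<Sum>f\<leftarrow>d. ?O e f) = 0" if cd: "(c, d) \<in> set P" for c d
    proof -
      have "distinct c" "distinct d" using cyc[OF cd] cycle_facts(2) by auto
      then have "(\<Sum>e\<leftarrow>c. \<Sum>f\<leftarrow>d. ?O e f) = link n Y (set c) (set d)"
        by (simp add: link_def sum_list_distinct_conv_sum_set)
      moreover have "link n Y (set (fst (c, d))) (set (snd (c, d))) = 0" using elim(1) cd Y by blast
      ultimately show ?thesis by simp
    qed
    then have "map (\<lambda>(c, d). \<Sum>e\<leftarrow>c. \<Sum>f\<leftarrow>d. ?O e f) P = map (\<lambda>x. 0) P"
      by (intro map_cong refl) (simp add: split_beta)
    then have "(\<Sum>(c, d)\<leftarrow>P. \<Sum>e\<leftarrow>c. \<Sum>f\<leftarrow>d. ?O e f) = 0"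
      by (simp only: sum_list_0)
    ultimately show False by simp
  qed
  then show False by simp
qed

section \<open>A digraph with sixteen cycle pairs of odd total linking number\<close>

text \<open>Deletes equal entries two at a time. An empty result certifies that every entry occurs an even number of
times, so that any sum over the list vanishes mod 2.\<close>

fun cancel_pairs :: "'a list \<Rightarrow> 'a list" where
  "cancel_pairs [] = []"
| "cancel_pairs (x # xs) = (let ys = cancel_pairs xs in if x \<in> set ys then remove1 x ys else x # ys)"

lemma sum_list_cancel_pairs: "sum_list (map F (cancel_pairs xs)) = (sum_list (map F xs) :: bit)"
proof (induction xs)
  case (Cons x xs)
  show ?case
  proof (cases "x \<in> set (cancel_pairs xs)")
    case True
    then have "sum_list (map F (cancel_pairs xs)) = F x + sum_list (map F (remove1 x (cancel_pairs xs)))"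
      by (rule sum_list_map_remove1)
    then show ?thesis using True Cons.IH[symmetric] by (simp add: Let_def)
  qed (simp add: Let_def Cons.IH)
qed simp

definition cycle_arcs :: "nat list \<Rightarrow> (nat \<times> nat) list" where
  "cycle_arcs vs = zip vs (rotate1 vs)"

text \<open>Up to the rotation \<open>0 \<rightarrow> 1 \<rightarrow> 2 \<rightarrow> 0\<close>, which is a symmetry of the digraph \<open>core\<close> below, there are eight different
pairs.\<close>

definition cycle_pairs :: "(nat list \<times> nat list) list" where
  "cycle_pairs =
    [([6,7,4],[0,1,2]), ([0,1,2],[6,7,3,4]), ([0,1,2],[6,7,5,4]), ([0,1,2],[6,7,3,5,4]),
     ([0,3,4],[6,7,5,1,2]), ([1,3,4],[6,7,5,2,0]), ([2,3,4],[6,7,5,0,1]),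
     ([0,3,5],[6,7,4,1,2]), ([1,3,5],[6,7,4,2,0]), ([2,3,5],[6,7,4,0,1]),
     ([6,7,4,0],[2,3,5,1]), ([6,7,4,1],[0,3,5,2]), ([6,7,4,2],[1,3,5,0]),
     ([6,7,5,0],[2,3,4,1]), ([6,7,5,1],[0,3,4,2]), ([6,7,5,2],[1,3,4,0])]"

definition core :: "(nat \<times> nat) list" where
  "core = [(0,1),(1,2),(2,0), (0,3),(1,3),(2,3), (0,6),(1,6),(2,6), (3,4),(3,5),
    (4,0),(4,1),(4,2),(4,6), (5,0),(5,1),(5,2),(5,4), (6,7), (7,3),(7,4),(7,5)]"

definition arc_pairs :: "((nat \<times> nat) \<times> (nat \<times> nat)) list" where
  "arc_pairs = concat (map (\<lambda>(c, d). List.product (cycle_arcs c) (cycle_arcs d)) cycle_pairs)"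

text \<open>The terms that have to be exchanged to bring each pair of arcs into a fixed order. Disjoint arcs have
different tails, so comparing tails is enough.\<close>

definition descents :: "((nat \<times> nat) \<times> (nat \<times> nat)) list" where
  "descents = filter (\<lambda>(e, f). fst f < fst e) arc_pairs"

definition vertex_pairs :: "(nat \<times> nat) list" where
  "vertex_pairs = concat (map (\<lambda>(e, f). [(fst e, fst f), (fst e, snd f), (snd e, fst f), (snd e, snd f)]) descents)"

lemma arc_pairs_disjoint:
  "\<forall>(e, f)\<in>set arc_pairs. e \<in> set core \<and> f \<in> set core \<and> {fst e, snd e} \<inter> {fst f, snd f} = {}"
  by code_simp

lemma arc_pairs_even:
  "cancel_pairs (map (\<lambda>(e, f). if fst f < fst e then (f, e) else (e, f)) arc_pairs) = []"
  by code_simp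

lemma descents_even:
  "cancel_pairs (concat (map (\<lambda>(e, f). [(fst e, f), (snd e, f), (fst f, e), (snd f, e)]) descents)) = []"
  by code_simp

lemma vertex_pairs_even:
  "cancel_pairs (map (\<lambda>(u, v). if v < u then (v, u) else (u, v)) vertex_pairs) = []"
  by code_simp

lemma vertex_descents_odd: "odd (length (filter (\<lambda>(u, v). v < u) vertex_pairs))"
  by code_simp

lemma vertex_pairs_distinct: "\<forall>(u, v)\<in>set vertex_pairs. u \<noteq> v \<and> u < 8 \<and> v < 8"
  by code_simp

lemma sum_list_even:
  assumes "cancel_pairs xs = []" shows "sum_list (map F xs) = (0 :: bit)"
  using sum_list_cancel_pairs[of F xs] assms by simp

lemma sum_list_filter: "(\<Sum>x\<leftarrow>xs. if Q x then F x else 0) = (\<Sum>x\<leftarrow>filter Q xs. F x :: bit)"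
  by (induction xs) auto

lemma sum_list_concat_map: "sum_list (concat (map g xs)) = (\<Sum>x\<leftarrow>xs. sum_list (g x))"
  by (induction xs) auto

lemma sum_list_one: "(\<Sum>x\<leftarrow>xs. 1 :: bit) = of_bool (odd (length xs))"
  by (induction xs) auto

text \<open>Three rounds of cancellation. Every unordered pair of disjoint arcs occurs an even number of times among
the crossing terms, so they cancel, up to the corrections that the crossing law prescribes for the
descents. In these corrections the positions of vertices relative to arcs cancel again, and what is
left are order relations between vertices, which cancel up to an odd number of inversions.\<close>

lemma cycle_pairs_sum:
  fixes G :: "(nat, nat \<times> nat) pre_digraph"
  assumes law: "crossing_law G X B s"
    and G: "{..<8} \<subseteq> verts G" "set core \<subseteq> arcs G" "tail G = fst" "head G = snd"
  shows "(\<Sum>(c, d)\<leftarrow>map (map_prod cycle_arcs cycle_arcs) cycle_pairs. \<Sum>e\<leftarrow>c. \<Sum>f\<leftarrow>d. X e f) = 1"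
proof -
  define R where "R e f = B (fst e) f + B (snd e) f + B (fst f) e + B (snd f) e
    + (s (fst e) (fst f) + s (fst e) (snd f) + s (snd e) (fst f) + s (snd e) (snd f))" for e f
  have X: "X e f = X f e + R e f" if "(e, f) \<in> set arc_pairs" for e f
  proof -
    have "e \<in> arcs G" "f \<in> arcs G" "{fst e, snd e} \<inter> {fst f, snd f} = {}"
      using that arc_pairs_disjoint G(2) by auto
    then have "X e f + X f e = R e f" using law unfolding crossing_law_def G(3,4) R_def by blast
    then show ?thesis by (cases "X e f"; cases "X f e"; cases "R e f") auto
  qed
  have "(\<Sum>(c, d)\<leftarrow>map (map_prod cycle_arcs cycle_arcs) cycle_pairs. \<Sum>e\<leftarrow>c. \<Sum>f\<leftarrow>d. X e f)
    = (\<Sum>(e, f)\<leftarrow>arc_pairs. X e f)"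
  proof -
    have "(\<Sum>e\<leftarrow>c. \<Sum>f\<leftarrow>d. X e f) = (\<Sum>(e, f)\<leftarrow>List.product c d. X e f)" for c d
      by (induction c) (auto simp: comp_def)
    then show ?thesis
      unfolding arc_pairs_def map_concat sum_list_concat_map map_map comp_def split_beta by simp
  qed
  also have "\<dots> = (\<Sum>x\<leftarrow>arc_pairs. (\<lambda>(e, f). X e f) (case x of (e, f) \<Rightarrow> if fst f < fst e then (f, e) else (e, f))
      + (if case x of (e, f) \<Rightarrow> fst f < fst e then (\<lambda>(e, f). R e f) x else 0))"
    by (intro arg_cong[of _ _ sum_list] map_cong refl) (use X in auto)
  also have "\<dots> = (\<Sum>x\<leftarrow>map (\<lambda>(e, f). if fst f < fst e then (f, e) else (e, f)) arc_pairs. (\<lambda>(e, f). X e f) x)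
      + (\<Sum>x\<leftarrow>descents. (\<lambda>(e, f). R e f) x)"
    unfolding sum_list_addf sum_list_filter descents_def map_map comp_def ..
  also have "(\<Sum>x\<leftarrow>map (\<lambda>(e, f). if fst f < fst e then (f, e) else (e, f)) arc_pairs. (\<lambda>(e, f). X e f) x) = 0"
    by (rule sum_list_even[OF arc_pairs_even])
  also have "(\<Sum>x\<leftarrow>descents. (\<lambda>(e, f). R e f) x)
    = (\<Sum>x\<leftarrow>concat (map (\<lambda>(e, f). [(fst e, f), (snd e, f), (fst f, e), (snd f, e)]) descents). (\<lambda>(v, f). B v f) x)
      + (\<Sum>x\<leftarrow>vertex_pairs. (\<lambda>(u, v). s u v) x)"
    unfolding vertex_pairs_def map_concat sum_list_concat_map map_map comp_def sum_list_addf[symmetric]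
    by (intro arg_cong[of _ _ sum_list] map_cong refl) (auto simp: R_def add.assoc)
  also have "(\<Sum>x\<leftarrow>concat (map (\<lambda>(e, f). [(fst e, f), (snd e, f), (fst f, e), (snd f, e)]) descents). (\<lambda>(v, f). B v f) x) = 0"
    by (rule sum_list_even[OF descents_even])
  also have "(\<Sum>x\<leftarrow>vertex_pairs. (\<lambda>(u, v). s u v) x)
    = (\<Sum>x\<leftarrow>vertex_pairs. (\<lambda>(u, v). s u v) (case x of (u, v) \<Rightarrow> if v < u then (v, u) else (u, v))
      + (if case x of (u, v) \<Rightarrow> v < u then 1 else 0))"
  proof (intro arg_cong[of _ _ sum_list] map_cong refl)
    fix x assume x: "x \<in> set vertex_pairs"
    obtain u v where uv: "x = (u, v)" by (cases x)
    have "s u v + s v u = 1"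
      using x uv vertex_pairs_distinct law G(1) by (fastforce simp: crossing_law_def subset_iff)
    then have "s u v = s v u + 1" by (cases "s u v"; cases "s v u") auto
    then show "(\<lambda>(u, v). s u v) x = (\<lambda>(u, v). s u v) (case x of (u, v) \<Rightarrow> if v < u then (v, u) else (u, v))
      + (if case x of (u, v) \<Rightarrow> v < u then 1 else 0)" by (auto simp: uv)
  qed
  also have "\<dots> = (\<Sum>x\<leftarrow>map (\<lambda>(u, v). if v < u then (v, u) else (u, v)) vertex_pairs. (\<lambda>(u, v). s u v) x)
      + (\<Sum>x\<leftarrow>filter (\<lambda>(u, v). v < u) vertex_pairs. 1)"
    unfolding sum_list_addf sum_list_filter map_map comp_def ..
  also have "(\<Sum>x\<leftarrow>map (\<lambda>(u, v). if v < u then (v, u) else (u, v)) vertex_pairs. (\<lambda>(u, v). s u v) x) = 0"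
    by (rule sum_list_even[OF vertex_pairs_even])
  also have "(\<Sum>x\<leftarrow>filter (\<lambda>(u, v). v < u) vertex_pairs. 1 :: bit) = 1"
    using vertex_descents_odd by (simp add: sum_list_one)
  finally show ?thesis by simp
qed

lemma cycle_arcs_cycle:
  assumes G: "wf_digraph G" "tail G = fst" "head G = snd"
    and c: "set (cycle_arcs vs) \<subseteq> arcs G" "distinct vs" "vs \<noteq> []"
  shows "pre_digraph.cycle G (cycle_arcs vs)"
proof -
  interpret wf_digraph G by (rule G(1))
  obtain v ws where vs: "vs = v # ws" using c(3) by (cases vs) auto
  have walk: "awalk u (zip (u # us) (us @ [w])) w \<and> awalk_verts u (zip (u # us) (us @ [w])) = u # us @ [w]"
    if "set (zip (u # us) (us @ [w])) \<subseteq> arcs G" for u us w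
    using that
  proof (induction us arbitrary: u)
    case Nil
    then have "w \<in> verts G" using head_in_verts[of "(u, w)"] G by simp
    then show ?case using Nil G by (simp add: awalk_Cons_iff awalk_Nil_iff)
  next
    case (Cons x us)
    then show ?case using G by (simp add: awalk_Cons_iff)
  qed
  have "cycle_arcs vs = zip (v # ws) (ws @ [v])" by (simp add: cycle_arcs_def vs)
  moreover from this have "awalk v (cycle_arcs vs) v" "awalk_verts v (cycle_arcs vs) = v # ws @ [v]"
    using walk[of v ws v] c(1) by auto
  ultimately show ?thesis using c(2) unfolding cycle_def vs by (intro exI[of _ v]) auto
qed

lemma cycle_pairs_good:
  "\<forall>(c, d)\<in>set cycle_pairs. set (cycle_arcs c) \<subseteq> set core \<and> set (cycle_arcs d) \<subseteq> set core
     \<and> distinct c \<and> distinct d \<and> c \<noteq> [] \<and> d \<noteq> [] \<and> fst ` set (cycle_arcs c) \<inter> fst ` set (cycle_arcs d) = {}"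
  by code_simp

text \<open>Every digraph that contains the arcs of \<open>core\<close> inherits its sixteen pairs of cycles.\<close>

lemma core_intrinsically_linked:
  fixes G :: "(nat, nat \<times> nat) pre_digraph"
  assumes G: "digraph G" "set core \<subseteq> arcs G" "tail G = fst" "head G = snd" "{..<8} \<subseteq> verts G"
  shows "intrinsically_linked G"
proof (rule intrinsically_linked_certificate[OF G(1), where P = "map (map_prod cycle_arcs cycle_arcs) cycle_pairs"])
  interpret digraph G by (rule G(1))
  fix c d assume "(c, d) \<in> set (map (map_prod cycle_arcs cycle_arcs) cycle_pairs)"
  then obtain x y where xy: "(x, y) \<in> set cycle_pairs" "c = cycle_arcs x" "d = cycle_arcs y" by auto
  then show "cycle c \<and> cycle d \<and> tail G ` set c \<inter> tail G ` set d = {}"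
    using bspec[OF cycle_pairs_good xy(1)] G(2,3) cycle_arcs_cycle[OF wf_digraph G(3,4)] by auto
qed (rule cycle_pairs_sum[OF _ G(5,2,3,4)])

section \<open>Reversal\<close>

lemma cycle_rev:
  assumes "wf_digraph G" "pre_digraph.cycle G c"
  shows "pre_digraph.cycle (reverse_digraph G) (rev c)"
proof -
  let ?R = "reverse_digraph G"
  interpret wf_digraph G by (rule assms(1))
  interpret R: wf_digraph ?R by unfold_locales (auto simp: reverse_digraph_def)
  have rev_simps: "verts ?R = verts G" "arcs ?R = arcs G" "tail ?R = head G" "head ?R = tail G"
    by (simp_all add: reverse_digraph_def)
  have rev_walk: "R.awalk v (rev p) u \<and> R.awalk_verts v (rev p) = rev (awalk_verts u p)" if "awalk u p v" for u p v
    using that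
  proof (induction p arbitrary: u)
    case Nil
    then show ?case by (auto simp: awalk_Nil_iff R.awalk_Nil_iff rev_simps)
  next
    case (Cons e p)
    then have e: "e \<in> arcs G" "u = tail G e" "awalk (head G e) p v" by (auto simp: awalk_Cons_iff)
    have "R.awalk (head G e) [e] u" using e by (auto simp: R.awalk_Cons_iff R.awalk_Nil_iff rev_simps)
    moreover have w: "R.awalk v (rev p) (head G e)" using Cons.IH[OF e(3)] by simp
    ultimately have a: "R.awalk v (rev p @ [e]) u" by (simp add: R.awalk_append_iff)
    moreover have "R.awalk_verts v (rev p @ [e]) = R.awalk_verts v (rev p) @ [u]"
      using a w by (subst R.awalk_verts_append) (auto simp: rev_simps e)
    ultimately show ?case using Cons.IH[OF e(3)] e by simp
  qed
  obtain u where u: "awalk u c u" "distinct (tl (awalk_verts u c))" "c \<noteq> []" using assms(2) by (auto simp: cycle_def)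
  have "hd (awalk_verts u c) = u" "last (awalk_verts u c) = u" using u(1) by auto
  moreover have "length (awalk_verts u c) \<ge> 2" using u(3) by (cases c) (auto simp: Suc_le_eq)
  ultimately obtain xs where "awalk_verts u c = u # xs @ [u]"
    by (cases "awalk_verts u c" rule: rev_cases; cases "butlast (awalk_verts u c)") auto
  then have "distinct (tl (R.awalk_verts u (rev c)))" using rev_walk[OF u(1)] u(2) by auto
  then show ?thesis using rev_walk[OF u(1)] u(3) unfolding R.cycle_def by blast
qed

lemma reverse_reverse: "reverse_digraph (reverse_digraph G) = G"
  by (simp add: reverse_digraph_def)

lemma tame_reverse:
  assumes "tame_S3_embedding G p g"
  shows "tame_S3_embedding (reverse_digraph G) p (\<lambda>e. reversepath (g e))"
proof -
  have "embedded_image (reverse_digraph G) p (\<lambda>e. reversepath (g e)) = embedded_image G p g"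
    by (simp add: embedded_image_def reverse_digraph_def)
  moreover have "S3_embedding (reverse_digraph G) p (\<lambda>e. reversepath (g e))"
    using assms unfolding tame_S3_embedding_def S3_embedding_def
    by (auto simp: reverse_digraph_def arc_reversepath insert_commute)
  ultimately show ?thesis using assms unfolding tame_S3_embedding_def by (simp add: reverse_digraph_def)
qed

text \<open>An embedding of the reversed digraph becomes one of the digraph by traversing every edge backwards;
the images of the edges, and hence of the cycles, stay the same.\<close>

lemma intrinsically_linked_reverse:
  assumes G: "wf_digraph G" and il: "intrinsically_linked G"
  shows "intrinsically_linked (reverse_digraph G)"
  unfolding intrinsically_linked_def
proof (intro allI impI)
  let ?R = "reverse_digraph G"
  interpret wf_digraph G by (rule G)
  fix p g assume "tame_S3_embedding ?R p g"
  then have "tame_S3_embedding G p (\<lambda>e. reversepath (g e))"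
    using tame_reverse[of ?R] by (simp add: reverse_reverse)
  then have "\<exists>c d. cycle c \<and> cycle d \<and> tail G ` set c \<inter> tail G ` set d = {} \<and>
     \<not> split_link (\<Union>e\<in>set c. path_image (reversepath (g e))) (\<Union>e\<in>set d. path_image (reversepath (g e)))"
    using il unfolding intrinsically_linked_def by blast
  then obtain c d where cd: "cycle c" "cycle d" "tail G ` set c \<inter> tail G ` set d = {}"
    "\<not> split_link (\<Union>e\<in>set c. path_image (g e)) (\<Union>e\<in>set d. path_image (g e))"
    unfolding path_image_reversepath by blast
  moreover have "tail ?R ` set (rev c) \<inter> tail ?R ` set (rev d) = {}"
    using cycle_facts(3)[OF cd(1)] cycle_facts(3)[OF cd(2)] cd(3) by (auto simp: reverse_digraph_def)
  ultimately show "\<exists>c d. pre_digraph.cycle ?R c \<and> pre_digraph.cycle ?R d \<and>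
        tail ?R ` set c \<inter> tail ?R ` set d = {} \<and>
        \<not> split_link (\<Union>e\<in>set c. path_image (g e)) (\<Union>e\<in>set d. path_image (g e))"
    using cycle_rev[OF G] by (intro exI[of _ "rev c"] exI[of _ "rev d"]) auto
qed

lemma tournament_reverse:
  assumes "tournament G" shows "tournament (reverse_digraph G)"
proof -
  interpret tournament G by (rule assms)
  show ?thesis
  proof
    show "e1 = e2" if "e1 \<in> arcs (reverse_digraph G)" "e2 \<in> arcs (reverse_digraph G)"
      "arc_to_ends (reverse_digraph G) e1 = arc_to_ends (reverse_digraph G) e2" for e1 e2
      using that no_multi_arcs[of e1 e2] by (auto simp: reverse_digraph_def arc_to_ends_def)
    show "\<exists>!e. e \<in> arcs (reverse_digraph G) \<and> {tail (reverse_digraph G) e, head (reverse_digraph G) e} = {u, v}"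
      if "u \<in> verts (reverse_digraph G)" "v \<in> verts (reverse_digraph G)" "u \<noteq> v" for u v
      using one_arc[of u v] that by (simp add: reverse_digraph_def insert_commute)
    show "tail (reverse_digraph G) e \<noteq> head (reverse_digraph G) e" if "e \<in> arcs (reverse_digraph G)" for e
      using that no_loops[of e] by (auto simp: reverse_digraph_def)
  qed (auto simp: reverse_digraph_def)
qed

section \<open>Tournaments containing the digraph\<close>

definition pair_tournament :: "(nat \<times> nat) list \<Rightarrow> (nat, nat \<times> nat) pre_digraph" where
  "pair_tournament es = \<lparr>verts = {..<8}, arcs = set es, tail = fst, head = snd\<rparr>"

text \<open>Bounded quantifiers over lists, so that the property is decided by rewriting.\<close>

definition one_way :: "(nat \<times> nat) list \<Rightarrow> bool" where
  "one_way es \<longleftrightarrow> distinct es \<and> (\<forall>(u, v)\<in>set es. u < 8 \<and> v < 8 \<and> u \<noteq> v) \<and>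
     (\<forall>u\<in>set [0..<8]. \<forall>v\<in>set [0..<8]. u \<noteq> v \<longrightarrow> ((u, v) \<in> set es) \<noteq> ((v, u) \<in> set es))"

lemma tournament_pair_tournament:
  assumes "one_way es" shows "tournament (pair_tournament es)"
proof -
  have "\<forall>(u, v)\<in>set es. u < 8 \<and> v < 8 \<and> u \<noteq> v" using assms unfolding one_way_def by blast
  then have es: "fst e < 8" "snd e < 8" "fst e \<noteq> snd e" if "e \<in> set es" for e using that by auto
  show ?thesis
  proof
    show "\<exists>!e. e \<in> arcs (pair_tournament es) \<and> {tail (pair_tournament es) e, head (pair_tournament es) e} = {u, v}"
      if uv: "u \<in> verts (pair_tournament es)" "v \<in> verts (pair_tournament es)" "u \<noteq> v" for u v
    proof -
      have "u \<in> set [0..<8]" "v \<in> set [0..<8]" using uv(1,2) by (simp_all add: pair_tournament_def)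
      then have one: "((u, v) \<in> set es) \<noteq> ((v, u) \<in> set es)"
        using assms uv(3) unfolding one_way_def by blast
      have ends: "{fst e, snd e} = {u, v} \<longleftrightarrow> e = (u, v) \<or> e = (v, u)" for e
        by (cases e) (auto simp: doubleton_eq_iff)
      show ?thesis
        unfolding pair_tournament_def pre_digraph.select_convs ends
        using one by (cases "(u, v) \<in> set es") (auto intro: ex1I[of _ "(u, v)"] ex1I[of _ "(v, u)"])
    qed
  qed (auto simp: pair_tournament_def arc_to_ends_def prod_eq_iff es)
qed

lemma score_sequence_pair_tournament:
  assumes "one_way es"
  shows "score_sequence (pair_tournament es) = sort (map (\<lambda>v. length (filter (\<lambda>e. fst e = v) es)) [0..<8])"
proof -
  have "out_degree (pair_tournament es) = (\<lambda>v. length (filter (\<lambda>e. fst e = v) es))"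
  proof
    fix v
    show "out_degree (pair_tournament es) v = length (filter (\<lambda>e. fst e = v) es)"
      using assms distinct_card[of "filter (\<lambda>e. fst e = v) es"]
      by (simp add: out_degree_def out_arcs_def pair_tournament_def one_way_def)
  qed
  moreover have "mset_set (verts (pair_tournament es)) = mset [0..<8]"
    by (simp add: pair_tournament_def atLeast0LessThan[symmetric] mset_upt)
  ultimately show ?thesis
    unfolding score_sequence_def by (simp only: mset_map[symmetric] sorted_list_of_multiset_mset)
qed

text \<open>The arcs \<open>es\<close> orient the edges that \<open>core\<close> leaves open. The same tournament, reversed, serves the dual
score sequence.\<close>

lemma core_representatives:
  assumes es: "one_way (core @ es)"
    and S: "sort (map (\<lambda>v. length (filter (\<lambda>e. fst e = v) (core @ es))) [0..<8]) = S"
  shows "has_intrinsically_linked_representative S \<and> has_intrinsically_linked_representative (dual_score S)"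
proof -
  let ?G = "pair_tournament (core @ es)"
  interpret tournament ?G by (rule tournament_pair_tournament[OF es])
  have T: "tournament ?G" by unfold_locales
  have sc: "score_sequence ?G = S" using score_sequence_pair_tournament[OF es] S by simp
  have il: "intrinsically_linked ?G"
    by (rule core_intrinsically_linked) (unfold_locales, auto simp: pair_tournament_def)
  have "has_intrinsically_linked_representative S"
    unfolding has_intrinsically_linked_representative_def using T sc il by blast
  moreover have "has_intrinsically_linked_representative (dual_score S)"
    unfolding has_intrinsically_linked_representative_def
    using tournament_reverse[OF T] score_sequence_reverse sc intrinsically_linked_reverse[OF wf_digraph il] by blast
  ultimately show ?thesis ..
qed

theorem proposition3p2:
  shows "\<forall>S \<in> {[2,3,3,3,3,4,4,6], [1,3,3,3,3,4,5,6], [1,3,3,3,4,4,5,5], [2,2,3,3,3,4,5,6]}.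
    has_intrinsically_linked_representative S \<and>
    has_intrinsically_linked_representative (dual_score S)"
proof -
  \<comment> \<open>The open edges are \<open>36\<close>, \<open>56\<close>, \<open>07\<close>, \<open>17\<close>, \<open>27\<close>; their orientations are read off from the required scores.\<close>
  have "has_intrinsically_linked_representative [2,3,3,3,3,4,4,6] \<and>
      has_intrinsically_linked_representative (dual_score [2,3,3,3,3,4,4,6])"
    by (rule core_representatives[where es = "[(3,6),(6,5),(7,0),(7,1),(7,2)]"]) code_simp+
  moreover have "has_intrinsically_linked_representative [1,3,3,3,3,4,5,6] \<and>
      has_intrinsically_linked_representative (dual_score [1,3,3,3,3,4,5,6])"
    by (rule core_representatives[where es = "[(3,6),(5,6),(7,0),(7,1),(7,2)]"]) code_simp+
  moreover have "has_intrinsically_linked_representative [1,3,3,3,4,4,5,5] \<and>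
      has_intrinsically_linked_representative (dual_score [1,3,3,3,4,4,5,5])"
    by (rule core_representatives[where es = "[(3,6),(5,6),(0,7),(7,1),(7,2)]"]) code_simp+
  moreover have "has_intrinsically_linked_representative [2,2,3,3,3,4,5,6] \<and>
      has_intrinsically_linked_representative (dual_score [2,2,3,3,3,4,5,6])"
    by (rule core_representatives[where es = "[(6,3),(5,6),(7,0),(7,1),(7,2)]"]) code_simp+
  ultimately show ?thesis by blast
qed

end
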